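(* In the standing setting, suppose Assumptions 1 and 2 hold. Then for every $\mu\in(0,1]$, $$\|y_\mu-\mu y'_\mu-y_*\|_G\le\frac{4\sigma_d\nu^2}{\gamma_d^2}\mu^2,\qquad \|x'_\mu\|_B\le\sigma_p:=\sigma_d\Big(1+\frac{16\nu^4}{\gamma_d^2}\Big),$$ where $y'_\mu,x'_\mu$ denote derivatives of the central path with respect to $\mu$.
   Context: Standing setting: $\mathbb E,\mathbb H$ finite-dimensional real spaces with duals, pairing $\langle\cdot,\cdot\rangle$; $K\subset\mathbb E$ a regular cone with dual cone $K^*$; $F$ a $\nu$-normal barrier for $K$ (a $\nu$-self-concordant barrier on $\operatorname{int}K$ with $F(\tau x)=F(x)-\nu\ln\tau$) and $F_*(s)=\max_{x\in\operatorname{int}K}\{-\langle s,x\rangle-F(x)\}$ its dual barrier. $A:\mathbb E\to\mathbb H^*$ linear, $c\in\mathbb E^*$, $b\in\mathbb H^*$; primal $\min\{\langle c,x\rangle:Ax=b,x\in K\}$, dual $\max\{\langle b,y\rangle:s+A^*y=c,s\in K^*\}$, both strictly feasible; $f^*$ optimal dual value. Central path: for $\mu>0$, $(x_\mu,s_\mu,y_\mu)$ with $Ax_\mu=b$, $s_\mu+A^*y_\mu=c$, $s_\mu=-\mu\nabla F(x_\mu)$. $s(y)=c-A^*y$, $Q=\{y:s(y)\in K^*\}$. $B=\nabla^2F(x_1)$; $\|x\|_B=\langle Bx,x\rangle^{1/2}$ ($x\in\mathbb E$), $\|s\|_B=\langle s,B^{-1}s\rangle^{1/2}$ ($s\in\mathbb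 E^*$); $G=AB^{-1}A^*$, $\|y\|_G=\langle Gy,y\rangle^{1/2}$. Assumption 1: there are an optimal dual pair $(s_*,y_* )$ and $\gamma_d>0$ with $f^*-\langle b,y\rangle\ge\gamma_d\|y-y_*\|_G$ for all $y\in Q$. Assumption 2: there is $\sigma_d$ with $\|\nabla^2F_*(s_\mu)s_*\|_B\le\sigma_d$ for all $\mu\in(0,1]$. *)

theory Defs
  imports "HOL-Analysis.Analysis"
begin

text \<open>Finite-dimensional spaces E, H are modelled by euclidean_space types; the dual
spaces are identified with the spaces themselves via the inner product, so the pairing
is the inner product.\<close>

definition regular_cone :: "'a::euclidean_space set \<Rightarrow> bool" where
  "regular_cone K \<longleftrightarrow> closed K \<and> convex K \<and> cone K \<and> interior K \<noteq> {} \<and>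
     (\<forall>x. x \<in> K \<and> - x \<in> K \<longrightarrow> x = 0)"

definition dual_cone :: "'a::euclidean_space set \<Rightarrow> 'a set" where
  "dual_cone K = {s. \<forall>x\<in>K. 0 \<le> s \<bullet> x}"

definition grad :: "('a::euclidean_space \<Rightarrow> real) \<Rightarrow> 'a \<Rightarrow> 'a" where
  "grad F x = (\<Sum>i\<in>Basis. frechet_derivative F (at x) i *\<^sub>R i)"

definition hess :: "('a::euclidean_space \<Rightarrow> real) \<Rightarrow> 'a \<Rightarrow> 'a \<Rightarrow> 'a" where
  "hess F x = frechet_derivative (grad F) (at x)"

definition third_dir :: "('a::euclidean_space \<Rightarrow> real) \<Rightarrow> 'a \<Rightarrow> 'a \<Rightarrow> real" where
  "third_dir F x h = frechet_derivative (\<lambda>z. hess F z h \<bullet> h) (at x) h"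

text \<open>nu-self-concordant barrier for the interior of K (three times continuously
differentiable, convex, closed i.e. tends to +infinity at the boundary, self-concordant,
and with barrier parameter nu).\<close>

definition sc_barrier :: "'a::euclidean_space set \<Rightarrow> ('a \<Rightarrow> real) \<Rightarrow> real \<Rightarrow> bool" where
  "sc_barrier K F \<nu> \<longleftrightarrow>
     (\<forall>x\<in>interior K. F differentiable (at x) \<and> grad F differentiable (at x) \<and>
         (\<forall>h. (\<lambda>z. hess F z h) differentiable (at x))) \<and>
     (\<forall>h k. continuous_on (interior K)
              (\<lambda>z. frechet_derivative (\<lambda>w. hess F w h) (at z) k)) \<and>
     convex_on (interior K) F \<and>
     (\<forall>z\<in>frontier K. filterlim F at_top (at z within interior K)) \<and>
     (\<forall>x\<in>interior K. \<forall>h. \<bar>third_dir F x h\<bar> \<le> 2 * (hess F x h \<bullet> h) powr (3/2)) \<and>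
     (\<forall>x\<in>interior K. \<forall>h. (grad F x \<bullet> h)\<^sup>2 \<le> \<nu> * (hess F x h \<bullet> h))"

definition normal_barrier :: "'a::euclidean_space set \<Rightarrow> ('a \<Rightarrow> real) \<Rightarrow> real \<Rightarrow> bool" where
  "normal_barrier K F \<nu> \<longleftrightarrow> sc_barrier K F \<nu> \<and>
     (\<forall>x\<in>interior K. \<forall>\<tau>>0. F (\<tau> *\<^sub>R x) = F x - \<nu> * ln \<tau>)"

definition dual_barrier :: "'a::euclidean_space set \<Rightarrow> ('a \<Rightarrow> real) \<Rightarrow> 'a \<Rightarrow> real" where
  "dual_barrier K F s = Sup ((\<lambda>x. - (s \<bullet> x) - F x) ` interior K)"

definition normB :: "('a::euclidean_space \<Rightarrow> 'a) \<Rightarrow> 'a \<Rightarrow> real" where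
  "normB B x = sqrt (B x \<bullet> x)"

definition normB_dual :: "('a::euclidean_space \<Rightarrow> 'a) \<Rightarrow> 'a \<Rightarrow> real" where
  "normB_dual B s = sqrt (s \<bullet> inv B s)"

definition Gop :: "('a::euclidean_space \<Rightarrow> 'b::euclidean_space) \<Rightarrow> ('a \<Rightarrow> 'a) \<Rightarrow> 'b \<Rightarrow> 'b" where
  "Gop A B y = A (inv B (adjoint A y))"

definition normG :: "('a::euclidean_space \<Rightarrow> 'b::euclidean_space) \<Rightarrow> ('a \<Rightarrow> 'a) \<Rightarrow> 'b \<Rightarrow> real" where
  "normG A B y = sqrt (Gop A B y \<bullet> y)"

definition dual_opt :: "'a::euclidean_space set \<Rightarrow> ('a \<Rightarrow> 'b::euclidean_space) \<Rightarrow> 'b \<Rightarrow> 'a \<Rightarrow> real" where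
  "dual_opt K A b c = Sup {b \<bullet> y | y. c - adjoint A y \<in> dual_cone K}"

end

theory Submission
  imports Defs
begin

text \<open>
Write \<open>H = \<nabla>\<^sup>2F(x\<^sub>\<mu>)\<close> and \<open>d = y\<^sub>\<mu> - \<mu> y'\<^sub>\<mu> - y\<^sub>*\<close>. Homogeneity and inversion of \<open>\<nabla>F\<close> give
\<open>\<nabla>\<^sup>2F\<^sub>*(s\<^sub>\<mu>) = \<mu>\<^sup>-\<^sup>2 H\<^sup>-\<^sup>1\<close>, and differentiating \<open>s\<^sub>\<mu> = -\<mu> \<nabla>F(x\<^sub>\<mu>)\<close> gives
\<open>x'\<^sub>\<mu> = \<mu>\<^sup>-\<^sup>2 H\<^sup>-\<^sup>1 (s\<^sub>* - A\<^sup>*d)\<close> with \<open>A x'\<^sub>\<mu> = 0\<close>. Hence \<open>\<langle>A\<^sup>*d, H\<^sup>-\<^sup>1 A\<^sup>*d\<rangle> \<le> \<mu>\<^sup>2 \<sigma>\<^sub>d \<parallel>d\<parallel>\<^sub>G\<close>, while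
the sharpness assumption, applied on the Dikin ellipsoid of radius \<open>\<mu>\<close> around \<open>s\<^sub>\<mu>\<close>, gives
\<open>\<gamma>\<^sub>d\<^sup>2 \<parallel>d\<parallel>\<^sub>G\<^sup>2 \<le> \<nu>\<^sup>2 \<langle>A\<^sup>*d, H\<^sup>-\<^sup>1 A\<^sup>*d\<rangle>\<close>; the first bound follows. The second one uses \<open>B \<preceq> 16 \<nu>\<^sup>2 H\<close>, which
holds because \<open>\<parallel>h\<parallel>\<^sub>B \<le> \<langle>-\<nabla>F(x\<^sub>1), h\<rangle>\<close> on \<open>K\<close> and \<open>x\<^sub>\<mu> \<plusminus> h \<in> K\<close> whenever \<open>\<parallel>h\<parallel>\<^sub>H < 1\<close>.
\<close>

section \<open>Positive definite operators\<close>

text \<open>Covers the metrics \<open>B\<close> and \<open>H\<close> and, through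
  \<open>spd_inv\<close>, their inverses, so that one set of norm and Cauchy-Schwarz facts serves
  primal and dual estimates alike.\<close>

locale spd_operator =
  fixes P :: "'a::euclidean_space \<Rightarrow> 'a"
  assumes linear_P: "linear P"
    and symmetric: "P x \<bullet> y = P y \<bullet> x"
    and positive: "x \<noteq> 0 \<Longrightarrow> 0 < P x \<bullet> x"
begin

lemma nonneg: "0 \<le> P x \<bullet> x"
  using positive[of x] linear_0[OF linear_P] by (cases "x = 0") auto

lemma normB_nonneg: "0 \<le> normB P x"
  by (simp add: normB_def nonneg)

lemma normB_sq: "(normB P x)\<^sup>2 = P x \<bullet> x"
  by (simp add: normB_def nonneg)

lemma normB_pos: "x \<noteq> 0 \<Longrightarrow> 0 < normB P x"
  by (simp add: normB_def positive)

lemma normB_scaleR: "normB P (r *\<^sub>R x) = \<bar>r\<bar> * normB P x"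
proof -
  have "P (r *\<^sub>R x) \<bullet> (r *\<^sub>R x) = r\<^sup>2 * (P x \<bullet> x)"
    by (simp add: linear_scale[OF linear_P] power2_eq_square)
  then show ?thesis by (simp add: normB_def real_sqrt_mult)
qed

lemma Cauchy_Schwarz: "\<bar>P x \<bullet> y\<bar> \<le> normB P x * normB P y"
proof -
  have "(P x \<bullet> y)\<^sup>2 \<le> (P x \<bullet> x) * (P y \<bullet> y)"
  proof (cases "y = 0")
    case False
    define a where "a = P y \<bullet> y"
    define m where "m = P x \<bullet> y"
    have a: "a > 0" using positive False a_def by simp
    \<comment> \<open>\<open>a x - m y\<close> is \<open>a\<close> times the component of
      \<open>x\<close> orthogonal to \<open>y\<close> in the metric \<open>P\<close>; the scaling
      avoids a division.\<close>
    have "0 \<le> P (a *\<^sub>R x - m *\<^sub>R y) \<bullet> (a *\<^sub>R x - m *\<^sub>R y)" by (rule nonneg)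
    also have "\<dots> = a * (a * (P x \<bullet> x) - m\<^sup>2)"
      using symmetric[of y x]
      by (simp add: linear_diff[OF linear_P] linear_scale[OF linear_P] inner_diff
          a_def m_def power2_eq_square algebra_simps)
    finally show ?thesis using a by (simp add: zero_le_mult_iff a_def m_def mult.commute)
  qed simp
  then have "\<bar>P x \<bullet> y\<bar> \<le> sqrt ((P x \<bullet> x) * (P y \<bullet> y))"
    by (metis real_sqrt_abs real_sqrt_le_mono)
  then show ?thesis by (simp add: normB_def real_sqrt_mult)
qed

lemma normB_triangle: "normB P (x + y) \<le> normB P x + normB P y"
proof (rule power2_le_imp_le)
  have "(normB P (x + y))\<^sup>2 = (normB P x)\<^sup>2 + 2 * (P x \<bullet> y) + (normB P y)\<^sup>2"
    using symmetric[of y x] by (simp add: normB_sq linear_add[OF linear_P] inner_add)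
  also have "\<dots> \<le> (normB P x + normB P y)\<^sup>2"
    using Cauchy_Schwarz[of x y] by (simp add: power2_sum)
  finally show "(normB P (x + y))\<^sup>2 \<le> (normB P x + normB P y)\<^sup>2" .
qed (simp add: normB_nonneg)

lemma normB_diff_le: "normB P (x - y) \<le> normB P x + normB P y"
  using normB_triangle[of x "- y"] normB_scaleR[of "-1" y] by simp

text \<open>Since \<open>2 h = (p + h) - (p - h)\<close>, estimates at two points symmetric about
  any centre \<open>p\<close> control \<open>h\<close>.\<close>

lemma normB_double_le: "2 * normB P h \<le> normB P (p + h) + normB P (p - h)"
  using normB_diff_le[of "p + h" "p - h"] normB_scaleR[of 2 h]
  by (simp add: scaleR_2)

lemma inj_P: "inj P"
proof (subst linear_inj_iff_eq_0[OF linear_P], intro allI impI)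
  show "x = 0" if "P x = 0" for x using positive[of x] that by force
qed

lemma surj_P: "surj P"
  by (rule linear_inj_imp_surj[OF linear_P inj_P])

lemma P_inv [simp]: "P (inv P v) = v"
  by (rule surj_f_inv_f[OF surj_P])

lemma inv_P [simp]: "inv P (P x) = x"
  by (rule inv_f_f[OF inj_P])

lemma linear_inv: "linear (inv P)"
  by (rule linearI) (metis inv_P P_inv linear_add[OF linear_P] linear_scale[OF linear_P])+

lemma spd_inv: "spd_operator (inv P)"
proof (rule spd_operator.intro)
  show "linear (inv P)" by (rule linear_inv)
  show "inv P x \<bullet> y = inv P y \<bullet> x" for x y
    by (metis P_inv symmetric inner_commute)
  show "0 < inv P x \<bullet> x" if "x \<noteq> 0" for x
    by (metis P_inv that positive inner_commute linear_0[OF linear_P])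
qed

lemma normB_inv: "normB P (inv P v) = normB (inv P) v"
  by (simp add: normB_def inner_commute)

lemma dual_Cauchy_Schwarz: "\<bar>v \<bullet> x\<bar> \<le> normB (inv P) v * normB P x"
  using Cauchy_Schwarz[of "inv P v" x] by (simp add: normB_inv)

text \<open>Moving \<open>A\<close> across the pairing as its adjoint turns the
  \<open>G\<close>-norm into a dual norm, so estimates can be made in the domain of
  \<open>A\<close>.\<close>

lemma normG_eq:
  fixes A :: "'a \<Rightarrow> 'b::euclidean_space"
  assumes "linear A"
  shows "normG A P y = normB (inv P) (adjoint A y)"
  by (simp add: normG_def Gop_def normB_def adjoint_works[OF assms, symmetric]
      inner_commute[of _ "adjoint A y"])

end

section \<open>Gradients and symmetric second derivatives\<close>

lemma frechet_derivative_eq_grad: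
  assumes "F differentiable (at x)"
  shows "frechet_derivative F (at x) h = grad F x \<bullet> h"
proof -
  have lin: "linear (frechet_derivative F (at x))"
    by (rule linear_frechet_derivative[OF assms])
  have "frechet_derivative F (at x) h = frechet_derivative F (at x) (\<Sum>i\<in>Basis. (h \<bullet> i) *\<^sub>R i)"
    by (simp add: euclidean_representation)
  also have "\<dots> = (\<Sum>i\<in>Basis. (h \<bullet> i) * frechet_derivative F (at x) i)"
    by (simp add: linear_sum[OF lin] linear_scale[OF lin])
  also have "\<dots> = grad F x \<bullet> h"
    by (simp add: grad_def inner_sum_left inner_commute[of h] mult.commute)
  finally show ?thesis .
qed

lemma grad_eqI:
  assumes "(F has_derivative (\<lambda>h. g \<bullet> h)) (at x)"
  shows "grad F x = g"
proof -
  have "F differentiable (at x)" using assms differentiableI by blast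
  then have "g \<bullet> h = grad F x \<bullet> h" for h
    using frechet_derivative_eq_grad[of F x h] frechet_derivative_at[OF assms] by metis
  then show ?thesis by (metis vector_eq_rdot)
qed

lemma has_derivative_along_line:
  assumes "(f has_derivative f') (at (x + t *\<^sub>R h))"
  shows "((\<lambda>t. f (x + t *\<^sub>R h)) has_derivative (\<lambda>s. f' (s *\<^sub>R h))) (at t)"
  by (rule has_derivative_compose[where f = "\<lambda>t. x + t *\<^sub>R h" and g = f, OF _ assms])
    (auto intro!: derivative_eq_intros)

lemma has_derivative_dilation:
  assumes "(f has_derivative f') (at (t *\<^sub>R x))"
  shows "((\<lambda>y. f (t *\<^sub>R y)) has_derivative (\<lambda>h. f' (t *\<^sub>R h))) (at x)"
  by (rule has_derivative_compose[where f = "\<lambda>y. t *\<^sub>R y" and g = f, OF _ assms])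
    (auto intro!: derivative_eq_intros)

text \<open>The mean value theorem in direction \<open>a\<close> turns the second difference into an
  increment of \<open>g\<close>, which differentiability at \<open>x\<close> expands
  linearly.\<close>

lemma second_difference_tendsto:
  fixes F :: "'a::real_inner \<Rightarrow> real"
  assumes S: "open S" "x \<in> S"
    and dF: "\<And>y. y \<in> S \<Longrightarrow> (F has_derivative (\<lambda>h. g y \<bullet> h)) (at y)"
    and dg: "(g has_derivative H) (at x)"
  shows "((\<lambda>t. (F (x + t *\<^sub>R a + t *\<^sub>R b) - F (x + t *\<^sub>R a) - F (x + t *\<^sub>R b) + F x) / t\<^sup>2)
           \<longlongrightarrow> H b \<bullet> a) (at_right 0)"
proof (rule tendstoI)
  fix \<epsilon> :: real assume \<epsilon>: "\<epsilon> > 0"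
  define N where "N = norm a + norm b + 1"
  have N: "N > 0" "norm a \<le> N" "norm b \<le> N" "norm a + norm b \<le> N"
    by (auto simp: N_def add_nonneg_pos)
  \<comment> \<open>Two remainders of size \<open>e * (t * N)\<close>, paired with \<open>a\<close>
    and divided by \<open>t\<close>, give \<open>2 * e * N * N\<close>, which is below
    \<open>\<epsilon>\<close>.\<close>
  define e where "e = \<epsilon> / (3 * N * N)"
  have e: "e > 0" using \<epsilon> N by (simp add: e_def)
  interpret H: bounded_linear H by (rule has_derivative_bounded_linear[OF dg])
  obtain d where d: "d > 0"
    "\<And>y. norm (y - x) < d \<Longrightarrow> norm (g y - g x - H (y - x)) \<le> e * norm (y - x)"
    using dg e unfolding has_derivative_at_alt by blast
  obtain r where r: "r > 0" "ball x r \<subseteq> S" using S openE by blast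
  define \<delta> where "\<delta> = min d r / N"
  have "\<delta> > 0" using d r N by (simp add: \<delta>_def)
  show "\<forall>\<^sub>F t in at_right 0. dist ((F (x + t *\<^sub>R a + t *\<^sub>R b) - F (x + t *\<^sub>R a) - F (x + t *\<^sub>R b) + F x)
     / t\<^sup>2) (H b \<bullet> a) < \<epsilon>"
    unfolding eventually_at_right_field
  proof (intro exI[of _ \<delta>] conjI \<open>\<delta> > 0\<close> allI impI)
    fix t :: real assume "0 < t" "t < \<delta>"
    have tN: "t * N < min d r" using \<open>t < \<delta>\<close> N by (simp add: \<delta>_def field_simps)
    have bnd: "norm (p *\<^sub>R a + q *\<^sub>R b) \<le> t * N" if "0 \<le> p" "p \<le> t" "0 \<le> q" "q \<le> t" for p q
    proof -
      have "norm (p *\<^sub>R a + q *\<^sub>R b) \<le> p * norm a + q * norm b"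
        using norm_triangle_ineq[of "p *\<^sub>R a" "q *\<^sub>R b"] that by simp
      also have "\<dots> \<le> t * norm a + t * norm b"
        using that by (intro add_mono mult_right_mono) auto
      also have "\<dots> \<le> t * N"
        using N(4) \<open>0 < t\<close> by (simp add: distrib_left[symmetric])
      finally show ?thesis .
    qed
    have inS: "x + p *\<^sub>R a + q *\<^sub>R b \<in> S" if "0 \<le> p" "p \<le> t" "0 \<le> q" "q \<le> t" for p q
    proof -
      have "dist x (x + (p *\<^sub>R a + q *\<^sub>R b)) = norm (p *\<^sub>R a + q *\<^sub>R b)"
        by (metis add_diff_cancel_left' dist_commute dist_norm)
      then have "x + (p *\<^sub>R a + q *\<^sub>R b) \<in> ball x r"
        using bnd[OF that] tN by simp
      then show ?thesis using r by (auto simp: add.assoc)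
    qed
    have gb: "norm (g (x + p *\<^sub>R a + q *\<^sub>R b) - g x - H (p *\<^sub>R a + q *\<^sub>R b)) \<le> e * (t * N)"
      if "0 \<le> p" "p \<le> t" "0 \<le> q" "q \<le> t" for p q
    proof -
      have "norm (g (x + p *\<^sub>R a + q *\<^sub>R b) - g x - H (p *\<^sub>R a + q *\<^sub>R b))
          \<le> e * norm (p *\<^sub>R a + q *\<^sub>R b)"
        using d(2)[of "x + p *\<^sub>R a + q *\<^sub>R b"] bnd[OF that] tN by (simp add: add.assoc)
      also have "\<dots> \<le> e * (t * N)" using bnd[OF that] e by simp
      finally show ?thesis .
    qed
    \<comment> \<open>\<open>\<phi>\<close> is the difference in direction \<open>b\<close> as a
      function of the position along \<open>a\<close>; the second difference is
      \<open>\<phi> t - \<phi> 0\<close>.\<close>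
    define \<phi> where "\<phi> s = F (x + s *\<^sub>R a + t *\<^sub>R b) - F (x + s *\<^sub>R a)" for s
    have D: "DERIV \<phi> s :> (g (x + s *\<^sub>R a + t *\<^sub>R b) - g (x + s *\<^sub>R a)) \<bullet> a"
      if "0 \<le> s" "s \<le> t" for s
    proof -
      have 1: "((\<lambda>s. F (x + s *\<^sub>R a + t *\<^sub>R b)) has_derivative
              (\<lambda>k. g (x + s *\<^sub>R a + t *\<^sub>R b) \<bullet> (k *\<^sub>R a))) (at s)"
        by (rule has_derivative_compose[where g = F, OF _ dF])
          (auto intro!: derivative_eq_intros inS that simp: \<open>0 < t\<close> less_imp_le)
      have 2: "((\<lambda>s. F (x + s *\<^sub>R a)) has_derivative
              (\<lambda>k. g (x + s *\<^sub>R a) \<bullet> (k *\<^sub>R a))) (at s)"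
        by (rule has_derivative_compose[where g = F, OF _ dF])
          (use inS[of s 0] that \<open>0 < t\<close> in \<open>auto intro!: derivative_eq_intros\<close>)
      show ?thesis unfolding \<phi>_def has_field_derivative_def
        by (rule has_derivative_eq_rhs[OF has_derivative_diff[OF 1 2]])
          (auto simp: inner_diff_left algebra_simps)
    qed
    obtain z where z: "0 < z" "z < t"
      "\<phi> t - \<phi> 0 = (t - 0) * ((g (x + z *\<^sub>R a + t *\<^sub>R b) - g (x + z *\<^sub>R a)) \<bullet> a)"
      using MVT2[OF \<open>0 < t\<close> D] by blast
    define r1 where "r1 = g (x + z *\<^sub>R a + t *\<^sub>R b) - g x - H (z *\<^sub>R a + t *\<^sub>R b)"
    define r2 where "r2 = g (x + z *\<^sub>R a) - g x - H (z *\<^sub>R a)"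
    have r1: "norm r1 \<le> e * (t * N)" unfolding r1_def by (rule gb) (use z in auto)
    have r2: "norm r2 \<le> e * (t * N)" using gb[of z 0] z \<open>0 < t\<close> by (simp add: r2_def)
    have "g (x + z *\<^sub>R a + t *\<^sub>R b) - g (x + z *\<^sub>R a) = t *\<^sub>R H b + (r1 - r2)"
      by (simp add: r1_def r2_def H.add H.scaleR)
    then have "\<phi> t - \<phi> 0 = t * t * (H b \<bullet> a) + t * ((r1 - r2) \<bullet> a)"
      unfolding z(3) by (simp only: inner_add_left inner_scaleR_left) (simp add: algebra_simps)
    then have "(\<phi> t - \<phi> 0) / t\<^sup>2 - H b \<bullet> a = ((r1 - r2) \<bullet> a) / t"
      using \<open>0 < t\<close> by (simp add: power2_eq_square field_simps)
    moreover have "\<bar>(r1 - r2) \<bullet> a\<bar> \<le> (2 * e * (t * N)) * N"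
    proof -
      have "\<bar>(r1 - r2) \<bullet> a\<bar> \<le> norm (r1 - r2) * norm a" by (rule Cauchy_Schwarz_ineq2)
      also have "\<dots> \<le> (2 * e * (t * N)) * N"
        using norm_triangle_ineq4[of r1 r2] r1 r2 N \<open>0 < t\<close> e by (intro mult_mono) auto
      finally show ?thesis .
    qed
    ultimately have "\<bar>(\<phi> t - \<phi> 0) / t\<^sup>2 - H b \<bullet> a\<bar> \<le> 2 * e * N * N"
      using \<open>0 < t\<close> by (simp add: abs_div_pos[symmetric] divide_le_eq mult_ac)
    also have "\<dots> < \<epsilon>" using N \<epsilon> by (simp add: e_def)
    finally show "dist ((F (x + t *\<^sub>R a + t *\<^sub>R b) - F (x + t *\<^sub>R a) - F (x + t *\<^sub>R b) + F x)
        / t\<^sup>2) (H b \<bullet> a) < \<epsilon>"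
      by (simp add: dist_real_def \<phi>_def diff_diff_eq2 diff_add_eq)
  qed
qed

text \<open>The second difference quotient is unchanged when \<open>a\<close> and \<open>b\<close>
  are swapped, so its two limits agree.\<close>

lemma second_derivative_symmetric:
  fixes F :: "'a::real_inner \<Rightarrow> real"
  assumes "open S" "x \<in> S"
    and "\<And>y. y \<in> S \<Longrightarrow> (F has_derivative (\<lambda>h. g y \<bullet> h)) (at y)"
    and "(g has_derivative H) (at x)"
  shows "H a \<bullet> b = H b \<bullet> a"
proof (rule tendsto_unique[OF trivial_limit_at_right_real])
  show "((\<lambda>t. (F (x + t *\<^sub>R a + t *\<^sub>R b) - F (x + t *\<^sub>R a) - F (x + t *\<^sub>R b) + F x) / t\<^sup>2)
           \<longlongrightarrow> H b \<bullet> a) (at_right 0)"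
    by (rule second_difference_tendsto[OF assms])
  show "((\<lambda>t. (F (x + t *\<^sub>R a + t *\<^sub>R b) - F (x + t *\<^sub>R a) - F (x + t *\<^sub>R b) + F x) / t\<^sup>2)
           \<longlongrightarrow> H a \<bullet> b) (at_right 0)"
    using second_difference_tendsto[OF assms, of b a] by (simp add: add_ac diff_diff_eq)
qed

lemma powr_three_halves:
  fixes u :: real
  assumes "0 \<le> u"
  shows "u powr (3/2) = u * sqrt u"
proof (cases "u = 0")
  case False
  then have "u powr (1 + 1/2) = u * sqrt u"
    using assms unfolding powr_add by (simp add: powr_half_sqrt)
  then show ?thesis by simp
qed simp

section \<open>Normal barriers\<close>

locale normal_barrier_cone =
  fixes K :: "'e::euclidean_space set" and F :: "'e \<Rightarrow> real" and \<nu> :: real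
  assumes cone: "regular_cone K" and barrier: "normal_barrier K F \<nu>"
begin

section \<open>Geometry of the cone and its interior\<close>

lemma closed_K: "closed K" and convex_K: "convex K" and cone_K: "cone K"
  and pointed_K: "x \<in> K \<Longrightarrow> - x \<in> K \<Longrightarrow> x = 0"
  using cone by (auto simp: regular_cone_def)

lemma convex_int: "convex (interior K)"
  by (rule convex_interior[OF convex_K])

lemma K_add: "x \<in> K \<Longrightarrow> y \<in> K \<Longrightarrow> x + y \<in> K"
proof -
  assume "x \<in> K" "y \<in> K"
  then have "(1/2) *\<^sub>R x + (1/2) *\<^sub>R y \<in> K" using convexD[OF convex_K, of x y "1/2" "1/2"] by simp
  then have "2 *\<^sub>R ((1/2) *\<^sub>R x + (1/2) *\<^sub>R y) \<in> K" using cone_K by (metis cone_def zero_le_numeral)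
  then show ?thesis by (simp add: scaleR_add_right)
qed

lemma K_scaleR: "x \<in> K \<Longrightarrow> 0 \<le> t \<Longrightarrow> t *\<^sub>R x \<in> K"
  using cone_K by (simp add: cone_def)

lemma int_scaleR: assumes "x \<in> interior K" "0 < t" shows "t *\<^sub>R x \<in> interior K"
proof -
  have "open ((\<lambda>x. t *\<^sub>R x) ` interior K)"
    using assms by (intro open_scaling) auto
  moreover have "(\<lambda>x. t *\<^sub>R x) ` interior K \<subseteq> K"
    using assms interior_subset by (auto intro!: K_scaleR)
  ultimately show ?thesis using assms interior_maximal by blast
qed

text \<open>The translate of the interior by \<open>h\<close> is open and lies in \<open>K\<close>,
  hence in the interior.\<close>

lemma int_add: assumes "x \<in> interior K" "h \<in> K" shows "x + h \<in> interior K"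
proof -
  have "open ((\<lambda>x. h + x) ` interior K)"
    by (intro open_translation) auto
  moreover have "(\<lambda>x. h + x) ` interior K \<subseteq> K"
    using assms interior_subset by (auto intro!: K_add)
  ultimately have "(\<lambda>x. h + x) ` interior K \<subseteq> interior K" using interior_maximal by blast
  then show ?thesis using assms by (auto simp: add.commute)
qed

lemma int_segment:
  assumes "x \<in> interior K" "x + t *\<^sub>R h \<in> interior K" "0 \<le> s" "s \<le> t"
  shows "x + s *\<^sub>R h \<in> interior K"
proof (cases "t = 0")
  case False
  then have t: "t > 0" using assms by auto
  have "(1 - s / t) *\<^sub>R x + (s / t) *\<^sub>R (x + t *\<^sub>R h) \<in> interior K"
    using assms t by (intro convexD[OF convex_int]) auto
  also have "(1 - s / t) *\<^sub>R x + (s / t) *\<^sub>R (x + t *\<^sub>R h) = x + s *\<^sub>R h"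
    using t by (simp add: algebra_simps)
  finally show ?thesis .
qed (use assms in auto)

section \<open>Derivatives of the barrier, also along lines\<close>

lemma sc: "sc_barrier K F \<nu>"
  using barrier by (simp add: normal_barrier_def)

lemma F_scale: "x \<in> interior K \<Longrightarrow> 0 < t \<Longrightarrow> F (t *\<^sub>R x) = F x - \<nu> * ln t"
  using barrier by (simp add: normal_barrier_def)

lemma F_has_derivative: "x \<in> interior K \<Longrightarrow> (F has_derivative (\<lambda>h. grad F x \<bullet> h)) (at x)"
proof -
  assume "x \<in> interior K"
  then have d: "F differentiable (at x)" using sc by (simp add: sc_barrier_def)
  then have "(F has_derivative frechet_derivative F (at x)) (at x)"
    by (simp add: frechet_derivative_works)
  then show ?thesis by (simp add: frechet_derivative_eq_grad[OF d, abs_def])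
qed

lemma grad_has_derivative: "x \<in> interior K \<Longrightarrow> (grad F has_derivative hess F x) (at x)"
  using sc by (simp add: sc_barrier_def hess_def frechet_derivative_works)

lemma linear_hess: "x \<in> interior K \<Longrightarrow> linear (hess F x)"
  using grad_has_derivative has_derivative_linear by blast

lemma hess_symmetric: "x \<in> interior K \<Longrightarrow> hess F x a \<bullet> b = hess F x b \<bullet> a"
  by (rule second_derivative_symmetric[where S = "interior K" and F = F and g = "grad F" and x = x])
    (auto intro: F_has_derivative grad_has_derivative)

lemma F_line:
  assumes "x + t *\<^sub>R h \<in> interior K"
  shows "((\<lambda>t. F (x + t *\<^sub>R h)) has_real_derivative grad F (x + t *\<^sub>R h) \<bullet> h) (at t)"
  unfolding has_field_derivative_def
  by (rule has_derivative_eq_rhs[OF has_derivative_along_line[OF F_has_derivative[OF assms]]])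
    (simp add: fun_eq_iff)

lemma grad_line:
  assumes "x + t *\<^sub>R h \<in> interior K"
  shows "((\<lambda>t. grad F (x + t *\<^sub>R h) \<bullet> k) has_real_derivative hess F (x + t *\<^sub>R h) h \<bullet> k) (at t)"
proof -
  have "((\<lambda>t. grad F (x + t *\<^sub>R h)) has_derivative (\<lambda>s. hess F (x + t *\<^sub>R h) (s *\<^sub>R h))) (at t)"
    by (rule has_derivative_along_line[OF grad_has_derivative[OF assms]])
  then show ?thesis unfolding has_field_derivative_def
    by (rule has_derivative_eq_rhs[OF has_derivative_inner_left])
      (simp add: fun_eq_iff linear_scale[OF linear_hess[OF assms]])
qed

lemma hess_line:
  assumes "x + t *\<^sub>R h \<in> interior K"
  shows "((\<lambda>t. hess F (x + t *\<^sub>R h) h \<bullet> h) has_real_derivative third_dir F (x + t *\<^sub>R h) h) (at t)"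
proof -
  let ?g = "\<lambda>z. hess F z h \<bullet> h"
  have "(\<lambda>z. hess F z h) differentiable (at (x + t *\<^sub>R h))"
    using sc assms by (simp add: sc_barrier_def)
  then have "?g differentiable (at (x + t *\<^sub>R h))"
    by (auto simp: differentiable_def intro: has_derivative_inner_left)
  then have d: "(?g has_derivative frechet_derivative ?g (at (x + t *\<^sub>R h))) (at (x + t *\<^sub>R h))"
    by (simp add: frechet_derivative_works)
  have "((\<lambda>t. ?g (x + t *\<^sub>R h)) has_derivative
      (\<lambda>s. frechet_derivative ?g (at (x + t *\<^sub>R h)) (s *\<^sub>R h))) (at t)"
    by (rule has_derivative_along_line[OF d])
  then show ?thesis unfolding has_field_derivative_def
    by (rule has_derivative_eq_rhs)
      (simp add: fun_eq_iff third_dir_def linear_scale[OF has_derivative_linear[OF d]])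
qed

lemma third_dir_le: "x \<in> interior K \<Longrightarrow> \<bar>third_dir F x h\<bar> \<le> 2 * (hess F x h \<bullet> h) powr (3/2)"
  using sc by (simp add: sc_barrier_def)

lemma grad_sq_le: "x \<in> interior K \<Longrightarrow> (grad F x \<bullet> h)\<^sup>2 \<le> \<nu> * (hess F x h \<bullet> h)"
  using sc by (simp add: sc_barrier_def)

section \<open>Consequences of logarithmic homogeneity\<close>

lemma grad_scale:
  assumes x: "x \<in> interior K" and t: "0 < t"
  shows "grad F (t *\<^sub>R x) = (1 / t) *\<^sub>R grad F x"
proof -
  \<comment> \<open>The dilated barrier is differentiated by the chain rule and, since it equals
    \<open>F y - \<nu> * ln t\<close> on the interior, also directly; uniqueness of the derivative
    compares the results.\<close>
  have "((\<lambda>y. F (t *\<^sub>R y)) has_derivative (\<lambda>h. grad F (t *\<^sub>R x) \<bullet> (t *\<^sub>R h))) (at x)"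
    by (rule has_derivative_dilation[OF F_has_derivative[OF int_scaleR[OF assms]]])
  moreover have "((\<lambda>y. F (t *\<^sub>R y)) has_derivative (\<lambda>h. grad F x \<bullet> h)) (at x)"
  proof (rule has_derivative_transform_within_open[where f = "\<lambda>y. F y - \<nu> * ln t" and s = "interior K"])
    show "((\<lambda>y. F y - \<nu> * ln t) has_derivative (\<lambda>h. grad F x \<bullet> h)) (at x)"
      by (rule derivative_eq_intros F_has_derivative[OF x] | simp)+
  qed (use x t F_scale in auto)
  ultimately have "(\<lambda>h. grad F (t *\<^sub>R x) \<bullet> (t *\<^sub>R h)) = (\<lambda>h. grad F x \<bullet> h)"
    by (rule has_derivative_unique)
  then have "(t *\<^sub>R grad F (t *\<^sub>R x)) \<bullet> h = grad F x \<bullet> h" for h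
    by (simp add: fun_eq_iff)
  then have "t *\<^sub>R grad F (t *\<^sub>R x) = grad F x" by (metis vector_eq_rdot)
  then show ?thesis using t by (metis divide_self_if less_irrefl scaleR_one scaleR_scaleR
      times_divide_eq_left mult_1)
qed

lemma hess_scale:
  assumes x: "x \<in> interior K" and t: "0 < t"
  shows "hess F (t *\<^sub>R x) h = (1 / t\<^sup>2) *\<^sub>R hess F x h"
proof -
  have "((\<lambda>y. grad F (t *\<^sub>R y)) has_derivative (\<lambda>h. hess F (t *\<^sub>R x) (t *\<^sub>R h))) (at x)"
    by (rule has_derivative_dilation[OF grad_has_derivative[OF int_scaleR[OF assms]]])
  moreover have "((\<lambda>y. grad F (t *\<^sub>R y)) has_derivative (\<lambda>h. (1 / t) *\<^sub>R hess F x h)) (at x)"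
  proof (rule has_derivative_transform_within_open[where f = "\<lambda>y. (1 / t) *\<^sub>R grad F y" and s = "interior K"])
    show "((\<lambda>y. (1 / t) *\<^sub>R grad F y) has_derivative (\<lambda>h. (1 / t) *\<^sub>R hess F x h)) (at x)"
      by (intro has_derivative_scaleR_right grad_has_derivative x)
  qed (use x t grad_scale in auto)
  ultimately have "(\<lambda>h. hess F (t *\<^sub>R x) (t *\<^sub>R h)) = (\<lambda>h. (1 / t) *\<^sub>R hess F x h)"
    by (rule has_derivative_unique)
  then have "t *\<^sub>R hess F (t *\<^sub>R x) h = (1 / t) *\<^sub>R hess F x h"
    by (metis linear_scale[OF linear_hess[OF int_scaleR[OF assms]]])
  then have "(1 / t) *\<^sub>R (t *\<^sub>R hess F (t *\<^sub>R x) h) = (1 / t) *\<^sub>R ((1 / t) *\<^sub>R hess F x h)"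
    by simp
  then show ?thesis using t by (simp add: power2_eq_square)
qed

text \<open>On the ray, \<open>x + t x = (1 + t) x\<close>, so homogeneity makes \<open>F\<close>
  explicit in \<open>t\<close> and its derivative at \<open>0\<close> can be read off.\<close>

lemma grad_euler: assumes x: "x \<in> interior K" shows "grad F x \<bullet> x = - \<nu>"
proof -
  have "((\<lambda>t. F (x + t *\<^sub>R x)) has_real_derivative grad F x \<bullet> x) (at 0)"
    using F_line[of x 0 x] x by simp
  moreover have "((\<lambda>t. F (x + t *\<^sub>R x)) has_real_derivative - \<nu>) (at 0)"
  proof (rule has_field_derivative_transform_within_open[where f = "\<lambda>t. F x - \<nu> * ln (1 + t)" and S = "{-1<..}"])
    show "((\<lambda>t. F x - \<nu> * ln (1 + t)) has_real_derivative - \<nu>) (at 0)"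
      by (auto intro!: derivative_eq_intros)
    show "F x - \<nu> * ln (1 + t) = F (x + t *\<^sub>R x)" if "t \<in> {-1<..}" for t
      using F_scale[OF x, of "1 + t"] that by (simp add: scaleR_add_left)
  qed auto
  ultimately show ?thesis by (rule DERIV_unique)
qed

lemma hess_euler: assumes x: "x \<in> interior K" shows "hess F x x = - grad F x"
proof -
  have "hess F x x \<bullet> k = - grad F x \<bullet> k" for k
  proof -
    have "((\<lambda>t. grad F (x + t *\<^sub>R x) \<bullet> k) has_real_derivative hess F x x \<bullet> k) (at 0)"
      using grad_line[of x 0 x] x by simp
    moreover have "((\<lambda>t. grad F (x + t *\<^sub>R x) \<bullet> k) has_real_derivative - grad F x \<bullet> k) (at 0)"
    proof (rule has_field_derivative_transform_within_open[where f = "\<lambda>t. (grad F x \<bullet> k) / (1 + t)" and S = "{-1<..}"])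
      show "((\<lambda>t. (grad F x \<bullet> k) / (1 + t)) has_real_derivative - grad F x \<bullet> k) (at 0)"
        by (auto intro!: derivative_eq_intros)
      show "(grad F x \<bullet> k) / (1 + t) = grad F (x + t *\<^sub>R x) \<bullet> k" if "t \<in> {-1<..}" for t
        using grad_scale[OF x, of "1 + t"] that by (simp add: scaleR_add_left)
    qed auto
    ultimately show ?thesis by (rule DERIV_unique)
  qed
  then show ?thesis by (metis vector_eq_rdot)
qed

section \<open>Convexity and signs of the derivatives\<close>

lemma F_above_tangent:
  assumes x: "x \<in> interior K" and y: "y \<in> interior K"
  shows "grad F x \<bullet> (y - x) \<le> F y - F x"
proof -
  have "((\<lambda>t. F (x + t *\<^sub>R (y - x))) has_real_derivative grad F x \<bullet> (y - x)) (at 0)"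
    using F_line[of x 0 "y - x"] x by simp
  then have "((\<lambda>t. (F (x + t *\<^sub>R (y - x)) - F x) / t) \<longlongrightarrow> grad F x \<bullet> (y - x)) (at_right 0)"
    unfolding has_field_derivative_iff by (simp add: filterlim_at_split)
  \<comment> \<open>Convexity keeps every right difference quotient below the chord slope, and the
    bound passes to the limit.\<close>
  moreover have "\<forall>\<^sub>F t in at_right 0. (F (x + t *\<^sub>R (y - x)) - F x) / t \<le> F y - F x"
    unfolding eventually_at_right_field
  proof (intro exI[of _ 1] conjI allI impI)
    fix t :: real assume t: "0 < t" "t < 1"
    have cv: "convex_on (interior K) F" using sc by (simp add: sc_barrier_def)
    have "F ((1 - t) *\<^sub>R x + t *\<^sub>R y) \<le> (1 - t) * F x + t * F y"
      by (rule convex_onD[OF cv]) (use t x y in auto)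
    moreover have "(1 - t) *\<^sub>R x + t *\<^sub>R y = x + t *\<^sub>R (y - x)" by (simp add: algebra_simps)
    ultimately show "(F (x + t *\<^sub>R (y - x)) - F x) / t \<le> F y - F x"
      using t by (simp add: field_simps)
  qed simp
  ultimately show ?thesis
    by (intro tendsto_upperbound[OF _ _ trivial_limit_at_right_real])
qed

lemma hess_nonneg: assumes x: "x \<in> interior K" shows "0 \<le> hess F x h \<bullet> h"
proof -
  have "((\<lambda>t. grad F (x + t *\<^sub>R h) \<bullet> h) has_real_derivative hess F x h \<bullet> h) (at 0)"
    using grad_line[of x 0 h] x by simp
  then have "((\<lambda>t. (grad F (x + t *\<^sub>R h) \<bullet> h - grad F x \<bullet> h) / t) \<longlongrightarrow> hess F x h \<bullet> h) (at_right 0)"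
    unfolding has_field_derivative_iff by (simp add: filterlim_at_split)
  moreover have "\<forall>\<^sub>F t in at_right 0. 0 \<le> (grad F (x + t *\<^sub>R h) \<bullet> h - grad F x \<bullet> h) / t"
  proof -
    have "((\<lambda>t. x + t *\<^sub>R h) \<longlongrightarrow> x + 0 *\<^sub>R h) (at_right 0)" by (intro tendsto_intros)
    then have "\<forall>\<^sub>F t in at_right 0. x + t *\<^sub>R h \<in> interior K"
      by (rule topological_tendstoD) (use x in auto)
    moreover have "\<forall>\<^sub>F t in at_right (0::real). 0 < t" by (rule eventually_at_right_less)
    ultimately show ?thesis
    proof eventually_elim
      case (elim t)
      \<comment> \<open>Adding the tangent inequalities at \<open>x\<close> and at
        \<open>x + t h\<close> eliminates \<open>F\<close> and leaves monotonicity of the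
        gradient.\<close>
      have "t * (grad F x \<bullet> h) \<le> t * (grad F (x + t *\<^sub>R h) \<bullet> h)"
        using F_above_tangent[OF x elim(1)] F_above_tangent[OF elim(1) x] by simp
      then show ?case using elim by simp
    qed
  qed
  ultimately show ?thesis
    by (intro tendsto_lowerbound[OF _ _ trivial_limit_at_right_real])
qed

lemma nu_nonneg: "0 \<le> \<nu>"
proof -
  obtain x where x: "x \<in> interior K" using cone by (auto simp: regular_cone_def)
  show ?thesis using hess_nonneg[OF x, of x] hess_euler[OF x] grad_euler[OF x] by simp
qed

text \<open>With a positive pairing the tangent at \<open>z\<close> would grow linearly along the
  ray \<open>t v\<close>, while \<open>F v - \<nu> * ln t\<close> does not grow. Boundary points are
  first pushed inside by a small multiple of \<open>z\<close>.\<close>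

lemma grad_nonpos: assumes z: "z \<in> interior K" and v: "v \<in> K" shows "grad F z \<bullet> v \<le> 0"
proof -
  have int: "grad F z \<bullet> v \<le> 0" if v: "v \<in> interior K" for v
  proof (rule ccontr)
    assume "\<not> ?thesis"
    then have p: "grad F z \<bullet> v > 0" by simp
    define M where "M = F v - F z - \<nu>"
    define t where "t = max 1 ((\<bar>M\<bar> + 1) / (grad F z \<bullet> v))"
    have t: "t \<ge> 1" "t * (grad F z \<bullet> v) \<ge> \<bar>M\<bar> + 1"
      using p by (auto simp: t_def field_simps max_def)
    have "grad F z \<bullet> (t *\<^sub>R v - z) \<le> F v - \<nu> * ln t - F z"
      using F_above_tangent[OF z int_scaleR[OF v, of t]] F_scale[OF v, of t] t by simp
    moreover have "0 \<le> \<nu> * ln t" using nu_nonneg t by simp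
    ultimately show False using t grad_euler[OF z] by (simp add: inner_diff_right M_def)
  qed
  show ?thesis
  proof (rule field_le_epsilon)
    fix e :: real assume e: "e > 0"
    \<comment> \<open>The push costs \<open>d * \<nu>\<close> by Euler's identity; the denominator
      \<open>\<nu> + 1\<close> is positive even for \<open>\<nu> = 0\<close>.\<close>
    define d where "d = e / (\<nu> + 1)"
    have d: "d > 0" "d * \<nu> \<le> e" using e nu_nonneg by (auto simp: d_def field_simps)
    have "grad F z \<bullet> (d *\<^sub>R z + v) \<le> 0"
      by (intro int int_add int_scaleR z v d)
    then show "grad F z \<bullet> v \<le> 0 + e" using grad_euler[OF z] d by (simp add: inner_add_right)
  qed
qed

section \<open>Staying in the interior; nondegenerate Hessians\<close>

lemma stays_in_interior:
  assumes x: "x \<in> interior K"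
    and bound: "\<And>t. 0 \<le> t \<Longrightarrow> t \<le> 1 \<Longrightarrow> x + t *\<^sub>R h \<in> interior K \<Longrightarrow> F (x + t *\<^sub>R h) \<le> M"
  shows "x + h \<in> interior K"
proof (rule ccontr)
  assume out: "x + h \<notin> interior K"
  \<comment> \<open>\<open>S\<close> is the set of exit times. It is closed, so a first exit time
    \<open>T\<close> exists; there the segment meets the frontier, where \<open>F\<close> blows up
    against the bound \<open>M\<close>.\<close>
  define S where "S = {0..1} \<inter> (\<lambda>t. x + t *\<^sub>R h) -` (- interior K)"
  have "closed S" unfolding S_def
    by (rule continuous_closed_preimage) (auto intro!: continuous_intros)
  moreover have "S \<noteq> {}" 
  proof -
    have "1 \<in> S" using out by (simp add: S_def)
    then show ?thesis by blast
  qed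
  moreover have bd: "bdd_below S" by (rule bdd_belowI[of _ 0]) (auto simp: S_def)
  ultimately have "Inf S \<in> S" by (intro closed_contains_Inf)
  define T where "T = Inf S"
  have T: "0 \<le> T" "T \<le> 1" "x + T *\<^sub>R h \<notin> interior K"
    using \<open>Inf S \<in> S\<close> by (auto simp: S_def T_def)
  then have "T > 0" using x by (cases "T = 0") auto
  have inside: "x + t *\<^sub>R h \<in> interior K" if "0 \<le> t" "t < T" for t
    using cInf_lower[OF _ bd, of t] that T by (force simp: S_def T_def)
  have ev: "\<forall>\<^sub>F t in at_left T. x + t *\<^sub>R h \<in> interior K \<and> F (x + t *\<^sub>R h) \<le> M"
    unfolding eventually_at_left_field
    using \<open>T > 0\<close> T inside bound by (intro exI[of _ 0]) auto
  have lim: "((\<lambda>t. x + t *\<^sub>R h) \<longlongrightarrow> x + T *\<^sub>R h) (at_left T)" by (intro tendsto_intros)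
  have "x + T *\<^sub>R h \<in> K"
    by (rule Lim_in_closed_set[OF closed_K _ trivial_limit_at_left_real lim])
      (rule eventually_mono[OF ev], use interior_subset in blast)
  then have "x + T *\<^sub>R h \<in> frontier K" using T closure_subset by (auto simp: frontier_def)
  then have top: "filterlim F at_top (at (x + T *\<^sub>R h) within interior K)"
    using sc by (simp add: sc_barrier_def)
  have "filterlim (\<lambda>t. x + t *\<^sub>R h) (at (x + T *\<^sub>R h) within interior K) (at_left T)"
    unfolding filterlim_at using lim ev T(3) by (auto elim!: eventually_mono)
  then have "filterlim (\<lambda>t. F (x + t *\<^sub>R h)) at_top (at_left T)"
    by (rule filterlim_compose[OF top])
  then have "\<forall>\<^sub>F t in at_left T. M < F (x + t *\<^sub>R h)"
    by (simp add: filterlim_at_top_dense)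
  with ev have "\<forall>\<^sub>F t in at_left T. False" by eventually_elim auto
  then show False by simp
qed

text \<open>The points \<open>x + (1/t) h\<close>, scaled by \<open>t\<close>, stay in the cone and
  tend to \<open>h\<close> as \<open>t\<close> tends to \<open>0\<close>.\<close>

lemma recession_direction:
  assumes "\<And>t. t > 0 \<Longrightarrow> x + t *\<^sub>R h \<in> K"
  shows "h \<in> K"
proof (rule Lim_in_closed_set[OF closed_K _ trivial_limit_at_right_real])
  show "((\<lambda>t. t *\<^sub>R (x + (1 / t) *\<^sub>R h)) \<longlongrightarrow> h) (at_right (0::real))"
  proof (rule Lim_transform_eventually)
    show "((\<lambda>t. t *\<^sub>R x + h) \<longlongrightarrow> h) (at_right 0)" by (auto intro!: tendsto_eq_intros)
    show "\<forall>\<^sub>F t in at_right 0. t *\<^sub>R x + h = t *\<^sub>R (x + (1 / t) *\<^sub>R h)"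
      using eventually_at_right_less[of "0::real"] by eventually_elim (simp add: scaleR_add_right)
  qed
  show "\<forall>\<^sub>F t in at_right 0. t *\<^sub>R (x + (1 / t) *\<^sub>R h) \<in> K"
    using eventually_at_right_less[of "0::real"] by eventually_elim (simp add: assms K_scaleR)
qed

text \<open>First step towards a nondegenerate Hessian: a direction of zero curvature never meets
  the boundary, because \<open>F\<close> does not increase along it.\<close>

lemma null_direction_stays:
  assumes x: "x \<in> interior K" and null: "hess F x h \<bullet> h = 0"
  shows "x + h \<in> interior K"
proof (rule stays_in_interior[OF x])
  fix t :: real assume t: "0 \<le> t" "t \<le> 1" and xt: "x + t *\<^sub>R h \<in> interior K"
  have seg: "x + s *\<^sub>R h \<in> interior K" if "0 \<le> s" "s \<le> t" for s
    by (rule int_segment[OF x xt that])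
  define u where "u s = hess F (x + s *\<^sub>R h) h \<bullet> h" for s
  have du: "DERIV u s :> third_dir F (x + s *\<^sub>R h) h" if "0 \<le> s" "s \<le> t" for s
    unfolding u_def by (rule hess_line[OF seg[OF that]])
  have u0: "0 \<le> u s" if "0 \<le> s" "s \<le> t" for s
    unfolding u_def by (rule hess_nonneg[OF seg[OF that]])
  txt \<open>Since \<open>u' \<le> 2 u\<^sup>3\<^sup>/\<^sup>2 \<le> 2 C u\<close>, Gronwall's argument forces \<open>u\<close> to vanish on the whole segment.\<close>
  have "continuous_on {0..t} (\<lambda>s. sqrt (u s))"
    by (intro continuous_intros continuous_at_imp_continuous_on) (auto intro!: DERIV_isCont du)
  then have "bounded ((\<lambda>s. sqrt (u s)) ` {0..t})"
    by (intro compact_imp_bounded compact_continuous_image) auto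
  then obtain C where C: "\<And>s. 0 \<le> s \<Longrightarrow> s \<le> t \<Longrightarrow> \<bar>sqrt (u s)\<bar> \<le> C"
    unfolding bounded_iff by force
  have "u s = 0" if s: "0 \<le> s" "s \<le> t" for s
  proof -
    have "u s * exp (- (2 * C * s)) \<le> u 0 * exp (- (2 * C * 0))"
    proof (rule DERIV_nonpos_imp_nonincreasing[OF s(1)])
      fix r assume r: "0 \<le> r" "r \<le> s"
      then have rt: "0 \<le> r" "r \<le> t" using s by auto
      have "third_dir F (x + r *\<^sub>R h) h \<le> 2 * (u r) powr (3/2)"
        using third_dir_le[OF seg[OF rt], of h] by (simp add: u_def)
      also have "\<dots> = 2 * (u r * sqrt (u r))"
        using u0[OF rt] by (simp add: powr_three_halves)
      also have "\<dots> \<le> 2 * (u r * C)"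
        using u0[OF rt] C[OF rt] by (intro mult_left_mono) auto
      finally have "third_dir F (x + r *\<^sub>R h) h - 2 * C * u r \<le> 0"
        by (simp add: mult_ac)
      then have "(third_dir F (x + r *\<^sub>R h) h - 2 * C * u r) * exp (- (2 * C * r)) \<le> 0"
        by (simp add: mult_nonpos_nonneg)
      moreover have "((\<lambda>s. u s * exp (- (2 * C * s))) has_real_derivative
        (third_dir F (x + r *\<^sub>R h) h - 2 * C * u r) * exp (- (2 * C * r))) (at r)"
        by (rule derivative_eq_intros du[OF rt] refl | simp add: algebra_simps)+
      ultimately show "\<exists>y. ((\<lambda>s. u s * exp (- (2 * C * s))) has_real_derivative y) (at r) \<and> y \<le> 0"
        by blast
    qed
    then have "u s \<le> 0" using null by (simp add: u_def mult_le_0_iff)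
    then show ?thesis using u0[OF s] by simp
  qed
  \<comment> \<open>The barrier-parameter inequality bounds the slope by the curvature, so zero
    curvature leaves zero slope.\<close>
  then have g0: "grad F (x + s *\<^sub>R h) \<bullet> h = 0" if "0 \<le> s" "s \<le> t" for s
    using grad_sq_le[OF seg[OF that], of h] that by (simp add: u_def)
  have "F (x + t *\<^sub>R h) \<le> F (x + 0 *\<^sub>R h)"
    by (rule DERIV_nonpos_imp_nonincreasing[OF t(1)]) (use F_line[OF seg] g0 in force)
  then show "F (x + t *\<^sub>R h) \<le> F x" by simp
qed

text \<open>A null direction \<open>h\<close> would put the whole line \<open>x + t h\<close> in
  \<open>K\<close>, hence both \<open>h\<close> and \<open>- h\<close>, against pointedness.\<close>

lemma spd_hess: assumes x: "x \<in> interior K" shows "spd_operator (hess F x)"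
proof (rule spd_operator.intro)
  show "linear (hess F x)" by (rule linear_hess[OF x])
  show "hess F x a \<bullet> b = hess F x b \<bullet> a" for a b by (rule hess_symmetric[OF x])
  show "0 < hess F x h \<bullet> h" if "h \<noteq> 0" for h
  proof (rule ccontr)
    assume "\<not> ?thesis"
    then have 0: "hess F x h \<bullet> h = 0" using hess_nonneg[OF x, of h] by simp
    have "x + t *\<^sub>R h \<in> K" for t
      using null_direction_stays[OF x, of "t *\<^sub>R h"] 0 interior_subset
      by (auto simp: linear_scale[OF linear_hess[OF x]])
    then have "h \<in> K" "- h \<in> K"
      using recession_direction[of x h] recession_direction[of x "- h"]
      by (metis, metis scaleR_minus_left scaleR_minus_right)
    then show False using pointed_K that by blast
  qed
qed

section \<open>Self-concordance and the local metric\<close>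

lemma normB_inverse_line:
  assumes x: "x \<in> interior K" and xt: "x + t *\<^sub>R h \<in> interior K" and t: "0 \<le> t" and h: "h \<noteq> 0"
  shows "\<bar>1 / normB (hess F (x + t *\<^sub>R h)) h - 1 / normB (hess F x) h\<bar> \<le> t"
proof (cases "t = 0")
  case False
  then have "0 < t" using t by simp
  have seg: "x + s *\<^sub>R h \<in> interior K" if "0 \<le> s" "s \<le> t" for s
    by (rule int_segment[OF x xt that])
  define u where "u s = hess F (x + s *\<^sub>R h) h \<bullet> h" for s
  have u: "0 < u s" if "0 \<le> s" "s \<le> t" for s
    unfolding u_def by (rule spd_operator.positive[OF spd_hess[OF seg[OF that]] h])
  txt \<open>Self-concordance says exactly that \<open>s \<mapsto> u(s)\<^sup>-\<^sup>1\<^sup>/\<^sup>2\<close> is 1-Lipschitz.\<close>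
  define D where "D s = - third_dir F (x + s *\<^sub>R h) h / (2 * u s * sqrt (u s))" for s
  have "((\<lambda>s. 1 / sqrt (u s)) has_real_derivative D s) (at s)" if s: "0 \<le> s" "s \<le> t" for s
  proof -
    have "(u has_real_derivative third_dir F (x + s *\<^sub>R h) h) (at s)"
      unfolding u_def by (rule hess_line[OF seg[OF s]])
    then show ?thesis
      using u[OF s] unfolding D_def
      by (auto intro!: derivative_eq_intros simp: field_simps)
  qed
  then obtain z where z: "0 < z" "z < t" "1 / sqrt (u t) - 1 / sqrt (u 0) = (t - 0) * D z"
    using MVT2[OF \<open>0 < t\<close>] by blast
  then have z': "0 \<le> z" "z \<le> t" by auto
  have "\<bar>third_dir F (x + z *\<^sub>R h) h\<bar> \<le> 2 * (u z) powr (3/2)"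
    using third_dir_le[OF seg[OF z'], of h] by (simp add: u_def)
  also have "\<dots> = 2 * u z * sqrt (u z)"
    using u[OF z'] by (simp add: powr_three_halves)
  finally have "\<bar>D z\<bar> \<le> 1"
    using u[OF z'] by (simp add: D_def abs_mult)
  then have "\<bar>t * D z\<bar> \<le> t"
    using \<open>0 < t\<close> by (simp add: abs_mult)
  then show ?thesis using z(3) by (simp add: u_def normB_def)
qed (use assms in simp)

text \<open>Along the ray \<open>x + t h\<close> the Lipschitz bound gives curvature at least
  \<open>(1 / (w + t))\<^sup>2\<close>, so slope plus \<open>1 / (w + t)\<close> is nondecreasing.
  As the slope is never positive, a large \<open>t\<close> gives the claim.\<close>

lemma normB_le_grad:
  assumes x: "x \<in> interior K" and h: "h \<in> K"
  shows "normB (hess F x) h \<le> - (grad F x \<bullet> h)"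
proof (cases "h = 0")
  case True
  then show ?thesis by (simp add: normB_def)
next
  case False
  define w where "w = 1 / normB (hess F x) h"
  have w: "w > 0" using spd_operator.normB_pos[OF spd_hess[OF x] False] by (simp add: w_def)
  have int: "x + t *\<^sub>R h \<in> interior K" if "0 \<le> t" for t
    by (intro int_add x K_scaleR h that)
  have mono: "grad F x \<bullet> h + 1 / w \<le> 1 / (w + t)" if t: "0 \<le> t" for t
  proof -
    have "grad F (x + 0 *\<^sub>R h) \<bullet> h + 1 / (w + 0) \<le> grad F (x + t *\<^sub>R h) \<bullet> h + 1 / (w + t)"
    proof (rule DERIV_nonneg_imp_nondecreasing[OF t])
      fix s assume s: "0 \<le> s" "s \<le> t"
      let ?u = "hess F (x + s *\<^sub>R h) h \<bullet> h"
      note spd = spd_hess[OF int[OF s(1)]]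
      have pos: "0 < normB (hess F (x + s *\<^sub>R h)) h" by (rule spd_operator.normB_pos[OF spd False])
      have "1 / normB (hess F (x + s *\<^sub>R h)) h \<le> w + s"
        using normB_inverse_line[OF x int[OF s(1)] s(1) False] by (simp add: w_def)
      then have "1 / (w + s) \<le> normB (hess F (x + s *\<^sub>R h)) h"
        using pos w s by (simp add: field_simps)
      then have "(1 / (w + s))\<^sup>2 \<le> (normB (hess F (x + s *\<^sub>R h)) h)\<^sup>2"
        by (rule power_mono) (use w s in auto)
      then have "(1 / (w + s))\<^sup>2 \<le> ?u" by (simp add: spd_operator.normB_sq[OF spd])
      moreover have "((\<lambda>s. grad F (x + s *\<^sub>R h) \<bullet> h + 1 / (w + s)) has_real_derivative
          ?u - (1 / (w + s))\<^sup>2) (at s)"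
        using w s by (auto intro!: derivative_eq_intros grad_line int simp: power2_eq_square divide_inverse)
      ultimately show "\<exists>y. ((\<lambda>s. grad F (x + s *\<^sub>R h) \<bullet> h + 1 / (w + s)) has_real_derivative y) (at s)
          \<and> 0 \<le> y" by (metis diff_ge_0_iff_ge)
    qed
    then show ?thesis using grad_nonpos[OF int[OF t] h] by simp
  qed
  have "grad F x \<bullet> h + 1 / w \<le> 0"
  proof (rule ccontr)
    assume "\<not> ?thesis"
    then have p: "0 < grad F x \<bullet> h + 1 / w" by simp
    let ?p = "grad F x \<bullet> h + 1 / w"
    \<comment> \<open>The choice \<open>t = q\<close> replaces the limit of \<open>t\<close> to
      infinity: it yields \<open>1 / q \<le> 1 / (w + q)\<close>, impossible for
      \<open>w > 0\<close>.\<close>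
    define q where "q = 1 / ?p"
    have q: "q > 0" "?p = 1 / q" using p by (auto simp: q_def)
    then have "1 / q \<le> 1 / (w + q)" using mono[of q] by simp
    moreover have "1 / (w + q) < 1 / q" using q w by (intro divide_strict_left_mono) auto
    ultimately show False by linarith
  qed
  then show ?thesis by (simp add: w_def)
qed

text \<open>The Lipschitz bound keeps the reciprocal of the local norm above
  \<open>w - 1 > 0\<close> on the segment, so the curvature is at most \<open>C\<close>. Integrating
  twice bounds \<open>F\<close>, and then \<open>stays_in_interior\<close> applies.\<close>

lemma Dikin_ellipsoid:
  assumes x: "x \<in> interior K" and h1: "normB (hess F x) h < 1"
  shows "x + h \<in> interior K"
proof (cases "h = 0")
  case False
  define w where "w = 1 / normB (hess F x) h"
  have "w > 1" using spd_operator.normB_pos[OF spd_hess[OF x] False] h1 by (simp add: w_def)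
  define C where "C = (1 / (w - 1))\<^sup>2"
  show ?thesis
  proof (rule stays_in_interior[OF x])
    fix t :: real assume t: "0 \<le> t" "t \<le> 1" and xt: "x + t *\<^sub>R h \<in> interior K"
    have seg: "x + s *\<^sub>R h \<in> interior K" if "0 \<le> s" "s \<le> t" for s
      by (rule int_segment[OF x xt that])
    have u: "hess F (x + s *\<^sub>R h) h \<bullet> h \<le> C" if s: "0 \<le> s" "s \<le> t" for s
    proof -
      note spd = spd_hess[OF seg[OF s]]
      have "0 < normB (hess F (x + s *\<^sub>R h)) h" by (rule spd_operator.normB_pos[OF spd False])
      moreover have "w - 1 \<le> 1 / normB (hess F (x + s *\<^sub>R h)) h"
        using normB_inverse_line[OF x seg[OF s] s(1) False] s t by (simp add: w_def)
      ultimately have "normB (hess F (x + s *\<^sub>R h)) h \<le> 1 / (w - 1)"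
        using \<open>w > 1\<close> by (simp add: field_simps)
      then have "(normB (hess F (x + s *\<^sub>R h)) h)\<^sup>2 \<le> C"
        unfolding C_def by (rule power_mono) (rule spd_operator.normB_nonneg[OF spd])
      then show ?thesis by (simp add: spd_operator.normB_sq[OF spd])
    qed
    have C: "0 \<le> C" by (simp add: C_def)
    have g: "grad F (x + s *\<^sub>R h) \<bullet> h \<le> \<bar>grad F x \<bullet> h\<bar> + C" if s: "0 \<le> s" "s \<le> t" for s
    proof -
      have "grad F (x + s *\<^sub>R h) \<bullet> h - C * s \<le> grad F (x + 0 *\<^sub>R h) \<bullet> h - C * 0"
      proof (rule DERIV_nonpos_imp_nonincreasing[OF s(1)])
        fix r assume "0 \<le> r" "r \<le> s"
        then have r: "0 \<le> r" "r \<le> t" using s by auto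
        have "((\<lambda>s. grad F (x + s *\<^sub>R h) \<bullet> h - C * s) has_real_derivative
            hess F (x + r *\<^sub>R h) h \<bullet> h - C) (at r)"
          by (auto intro!: derivative_eq_intros grad_line seg r)
        then show "\<exists>y. ((\<lambda>s. grad F (x + s *\<^sub>R h) \<bullet> h - C * s) has_real_derivative y) (at r) \<and> y \<le> 0"
          using u[OF r] by fastforce
      qed
      moreover have "C * s \<le> C" using C s t by (simp add: mult_left_le)
      ultimately show ?thesis by simp
    qed
    let ?M = "\<bar>grad F x \<bullet> h\<bar> + C"
    have "F (x + t *\<^sub>R h) - ?M * t \<le> F (x + 0 *\<^sub>R h) - ?M * 0"
    proof (rule DERIV_nonpos_imp_nonincreasing[OF t(1)])
      fix r assume r: "0 \<le> r" "r \<le> t"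
      have "((\<lambda>s. F (x + s *\<^sub>R h) - ?M * s) has_real_derivative
          grad F (x + r *\<^sub>R h) \<bullet> h - ?M) (at r)"
        by (auto intro!: derivative_eq_intros F_line seg r)
      then show "\<exists>y. ((\<lambda>s. F (x + s *\<^sub>R h) - ?M * s) has_real_derivative y) (at r) \<and> y \<le> 0"
        using g[OF r] by fastforce
    qed
    moreover have "?M * t \<le> ?M" using C t by (simp add: mult_left_le)
    ultimately show "F (x + t *\<^sub>R h) \<le> F x + ?M" by simp
  qed
qed (use x in simp)

text \<open>\<open>normB_le_grad\<close> at \<open>y\<close> applies to both \<open>x + k\<close>
  and \<open>x - k\<close> when \<open>k\<close> is in the Dikin ellipsoid of \<open>x\<close>; the
  terms in \<open>k\<close> cancel in the sum.\<close>

lemma normB_hess_compare: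
  assumes x: "x \<in> interior K" and y: "y \<in> interior K"
  shows "normB (hess F y) h \<le> 2 * (- (grad F y \<bullet> x)) * normB (hess F x) h"
proof (cases "h = 0")
  case True
  then show ?thesis by (simp add: normB_def)
next
  case False
  interpret X: spd_operator "hess F x" by (rule spd_hess[OF x])
  interpret Y: spd_operator "hess F y" by (rule spd_hess[OF y])
  define r where "r = normB (hess F x) h"
  have r: "r > 0" using X.normB_pos[OF False] by (simp add: r_def)
  \<comment> \<open>Length \<open>1/2\<close> is strictly inside the unit ellipsoid and is the
    source of the factor \<open>2\<close> in the bound.\<close>
  define k where "k = (1 / (2 * r)) *\<^sub>R h"
  have k: "normB (hess F x) k = 1 / 2" "normB (hess F x) (- k) = 1 / 2"
    using r X.normB_scaleR[of "1 / (2 * r)" h] X.normB_scaleR[of "-1" k]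
    by (simp_all add: k_def r_def)
  have "x + k \<in> K" "x - k \<in> K"
    using Dikin_ellipsoid[OF x, of k] Dikin_ellipsoid[OF x, of "- k"] k interior_subset by auto
  then have "normB (hess F y) (x + k) + normB (hess F y) (x - k)
      \<le> - (grad F y \<bullet> (x + k)) - (grad F y \<bullet> (x - k))"
    using normB_le_grad[OF y, of "x + k"] normB_le_grad[OF y, of "x - k"] by linarith
  then have "normB (hess F y) k \<le> - (grad F y \<bullet> x)"
    using Y.normB_double_le[of k x] by (simp add: inner_add_right inner_diff_right)
  then show ?thesis
    using r Y.normB_scaleR[of "1 / (2 * r)" h]
    by (simp add: k_def r_def[symmetric] pos_divide_le_eq mult_ac)
qed

text \<open>The dual counterpart of the Dikin ellipsoid, centred at \<open>- \<mu> grad F x\<close>.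
  Cauchy-Schwarz in dual norms and \<open>normB_le_grad\<close> give it without calculus on
  \<open>dual_barrier\<close>.\<close>

lemma dual_cone_ellipsoid:
  assumes x: "x \<in> interior K" and v: "normB (inv (hess F x)) v \<le> \<mu>"
  shows "v - \<mu> *\<^sub>R grad F x \<in> dual_cone K"
  unfolding dual_cone_def
proof (intro CollectI ballI)
  interpret X: spd_operator "hess F x" by (rule spd_hess[OF x])
  interpret X': spd_operator "inv (hess F x)" by (rule X.spd_inv)
  fix z assume z: "z \<in> K"
  have "\<bar>v \<bullet> z\<bar> \<le> normB (inv (hess F x)) v * normB (hess F x) z"
    by (rule X.dual_Cauchy_Schwarz)
  also have "\<dots> \<le> \<mu> * - (grad F x \<bullet> z)"
    using v normB_le_grad[OF x z] X.normB_nonneg X'.normB_nonneg[of v] by (intro mult_mono) auto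
  finally show "0 \<le> (v - \<mu> *\<^sub>R grad F x) \<bullet> z" by (simp add: inner_diff_left)
qed

section \<open>The dual barrier and its Hessian\<close>

lemma inj_on_grad: "inj_on (grad F) (interior K)"
proof (rule inj_onI, rule ccontr)
  fix x y assume x: "x \<in> interior K" and y: "y \<in> interior K" and eq: "grad F x = grad F y" and "x \<noteq> y"
  define h where "h = y - x"
  have h: "h \<noteq> 0" using \<open>x \<noteq> y\<close> by (simp add: h_def)
  have seg: "x + s *\<^sub>R h \<in> interior K" if "0 \<le> s" "s \<le> 1" for s
    using int_segment[OF x, of 1 h s] y that by (simp add: h_def)
  \<comment> \<open>Positive curvature makes the slope strictly increasing along the segment, so its
    ends cannot share a gradient.\<close>
  have "grad F (x + 0 *\<^sub>R h) \<bullet> h < grad F (x + 1 *\<^sub>R h) \<bullet> h"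
  proof (rule DERIV_pos_imp_increasing[OF zero_less_one])
    fix s :: real assume "0 \<le> s" "s \<le> 1"
    then have s: "x + s *\<^sub>R h \<in> interior K" by (rule seg)
    show "\<exists>d. ((\<lambda>s. grad F (x + s *\<^sub>R h) \<bullet> h) has_real_derivative d) (at s) \<and> 0 < d"
      using grad_line[OF s] spd_operator.positive[OF spd_hess[OF s] h] by blast
  qed
  then show False using eq by (simp add: h_def)
qed

text \<open>By the tangent inequality the maximum defining the dual barrier at
  \<open>- grad F x\<close> is attained at \<open>x\<close> itself.\<close>

lemma dual_barrier_eq:
  assumes x: "x \<in> interior K"
  shows "dual_barrier K F (- grad F x) = grad F x \<bullet> x - F x"
  unfolding dual_barrier_def
proof (rule cSup_eq_maximum)
  show "grad F x \<bullet> x - F x \<in> (\<lambda>z. - ((- grad F x) \<bullet> z) - F z) ` interior K"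
    using x by (auto intro!: image_eqI[of _ _ x])
  show "w \<le> grad F x \<bullet> x - F x" if "w \<in> (\<lambda>z. - ((- grad F x) \<bullet> z) - F z) ` interior K" for w
    using that by (auto dest!: F_above_tangent[OF x] simp: inner_diff_right)
qed

text \<open>\<open>g\<close> is the inverse of the negative gradient map. Invariance of domain makes
  the image \<open>U\<close> open and \<open>g\<close> continuous, after which the rule for inverse
  functions yields its derivative.\<close>

lemma dual_barrier_derivatives:
  obtains U g where "open U" "U = (\<lambda>x. - grad F x) ` interior K"
    "\<And>x. x \<in> interior K \<Longrightarrow> g (- grad F x) = x"
    "\<And>s. s \<in> U \<Longrightarrow> grad (dual_barrier K F) s = - g s"
    "\<And>s. s \<in> U \<Longrightarrow> (g has_derivative (\<lambda>v. - inv (hess F (g s)) v)) (at s)"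
proof -
  define f where "f x = - grad F x" for x
  define U where "U = f ` interior K"
  have contf: "continuous_on (interior K) f"
    unfolding f_def
    by (intro continuous_intros continuous_at_imp_continuous_on ballI
        has_derivative_continuous[OF grad_has_derivative])
  have injf: "inj_on f (interior K)"
    using inj_on_grad by (simp add: f_def inj_on_def)
  have "open U"
    unfolding U_def by (rule invariance_of_domain[OF contf _ injf]) simp
  obtain g where hom: "homeomorphism (interior K) U f g"
    using invariance_of_domain_homeomorphism[OF _ contf _ injf] unfolding U_def by auto
  have gf: "g (f x) = x" if "x \<in> interior K" for x
    using hom that by (simp add: homeomorphism_def)
  have fg: "f (g s) = s" and gK: "g s \<in> interior K" if "s \<in> U" for s
    using hom that by (auto simp: homeomorphism_def)
  have contg: "isCont g s" if "s \<in> U" for s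
    using hom \<open>open U\<close> that by (auto simp: homeomorphism_def continuous_on_eq_continuous_at)
  have val: "dual_barrier K F s = - (s \<bullet> g s) - F (g s)" if "s \<in> U" for s
  proof -
    have "grad F (g s) = - s" using fg[OF that] unfolding f_def by (metis minus_minus)
    then show ?thesis using dual_barrier_eq[OF gK[OF that]] by simp
  qed
  \<comment> \<open>\<open>- g s\<close> is a subgradient of the dual barrier at \<open>s\<close>;
    this is the tangent inequality of \<open>F\<close> between \<open>g s'\<close> and
    \<open>g s\<close>.\<close>
  have sub: "dual_barrier K F s' \<ge> dual_barrier K F s - (s' - s) \<bullet> g s" if s: "s \<in> U" "s' \<in> U" for s s'
  proof -
    have "grad F (g s') \<bullet> (g s - g s') \<le> F (g s) - F (g s')"
      by (rule F_above_tangent[OF gK gK]) (use s in auto)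
    moreover have "grad F (g s') = - s'" using fg[OF s(2)] unfolding f_def by (metis minus_minus)
    ultimately show ?thesis
      using val s by (simp add: inner_diff_left inner_diff_right)
  qed
  have dg: "(g has_derivative (\<lambda>v. - inv (hess F (g s)) v)) (at s)" if s: "s \<in> U" for s
  proof (rule has_derivative_inverse_basic[where f = f and T = U, OF _ _ _ contg[OF s] \<open>open U\<close> s fg])
    interpret X: spd_operator "hess F (g s)" by (rule spd_hess[OF gK[OF s]])
    show "(f has_derivative (\<lambda>h. - hess F (g s) h)) (at (g s))"
      unfolding f_def by (intro has_derivative_minus grad_has_derivative gK s)
    show "bounded_linear (\<lambda>v. - inv (hess F (g s)) v)"
      by (intro bounded_linear_minus linear_conv_bounded_linear[THEN iffD1] X.linear_inv)
    show "(\<lambda>v. - inv (hess F (g s)) v) \<circ> (\<lambda>h. - hess F (g s) h) = id"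
      by (simp add: fun_eq_iff linear_neg[OF X.linear_inv])
  qed
  txt \<open>The subgradient inequality in both directions reduces differentiability of \<open>F\<^sub>*\<close> to continuity of \<open>g\<close>.\<close>
  have dd: "(dual_barrier K F has_derivative (\<lambda>v. (- g s) \<bullet> v)) (at s)" if s: "s \<in> U" for s
    unfolding has_derivative_at_alt
  proof (intro conjI allI impI)
    show "bounded_linear ((\<bullet>) (- g s))" by (rule bounded_linear_inner_right)
    fix e :: real assume "e > 0"
    then obtain d where d: "d > 0" "\<And>s'. dist s' s < d \<Longrightarrow> dist (g s') (g s) < e"
      using contg[OF s] by (metis continuous_at_eps_delta dist_commute)
    obtain r where r: "r > 0" "ball s r \<subseteq> U" using \<open>open U\<close> s openE by blast
    show "\<exists>d>0. \<forall>y. norm (y - s) < d \<longrightarrow>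
        norm (dual_barrier K F y - dual_barrier K F s - - g s \<bullet> (y - s)) \<le> e * norm (y - s)"
    proof (intro exI[of _ "min d r"] conjI allI impI)
      fix y assume y: "norm (y - s) < min d r"
      then have yU: "y \<in> U" using r by (auto simp: dist_norm norm_minus_commute)
      have "norm (dual_barrier K F y - dual_barrier K F s - - g s \<bullet> (y - s)) \<le> \<bar>(y - s) \<bullet> (g s - g y)\<bar>"
        using sub[OF s yU] sub[OF yU s]
        by (simp add: inner_diff_left inner_diff_right inner_commute)
      also have "\<dots> \<le> norm (y - s) * norm (g s - g y)" by (rule Cauchy_Schwarz_ineq2)
      also have "\<dots> \<le> norm (y - s) * e"
        using d(2)[of y] y by (intro mult_left_mono) (auto simp: dist_norm norm_minus_commute)
      finally show "norm (dual_barrier K F y - dual_barrier K F s - - g s \<bullet> (y - s)) \<le> e * norm (y - s)"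
        by (simp add: mult.commute)
    qed (use d r in auto)
  qed
  show ?thesis
    by (rule that[OF \<open>open U\<close> _ _ grad_eqI[OF dd] dg]) (use gf in \<open>auto simp: U_def f_def\<close>)
qed

lemma hess_dual_barrier:
  assumes x: "x \<in> interior K" and \<mu>: "0 < \<mu>"
  shows "hess (dual_barrier K F) (- (\<mu> *\<^sub>R grad F x)) v = (1 / \<mu>\<^sup>2) *\<^sub>R inv (hess F x) v"
proof -
  \<comment> \<open>Dividing \<open>x\<close> by \<open>\<mu>\<close> multiplies its gradient by
    \<open>\<mu>\<close>, so the dual point is \<open>- grad F z\<close> and the derivative of
    \<open>g\<close> applies there; \<open>hess_scale\<close> then supplies the squared
    factor.\<close>
  define z where "z = (1 / \<mu>) *\<^sub>R x"
  have z: "z \<in> interior K" unfolding z_def by (intro int_scaleR x) (use \<mu> in simp)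
  define s where "s = - grad F z"
  have s: "- (\<mu> *\<^sub>R grad F x) = s"
    using grad_scale[OF x, of "1 / \<mu>"] \<mu> by (simp add: s_def z_def)
  interpret X: spd_operator "hess F x" by (rule spd_hess[OF x])
  interpret Z: spd_operator "hess F z" by (rule spd_hess[OF z])
  obtain U g where U: "open U" "U = (\<lambda>x. - grad F x) ` interior K"
    "\<And>x. x \<in> interior K \<Longrightarrow> g (- grad F x) = x"
    "\<And>s. s \<in> U \<Longrightarrow> grad (dual_barrier K F) s = - g s"
    "\<And>s. s \<in> U \<Longrightarrow> (g has_derivative (\<lambda>v. - inv (hess F (g s)) v)) (at s)"
    using dual_barrier_derivatives by metis
  have sU: "s \<in> U" using U(2) z by (auto simp: s_def)
  have gs: "g s = z" using U(3)[OF z] by (simp add: s_def)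
  have "((\<lambda>s. - g s) has_derivative (\<lambda>v. - (- inv (hess F z) v))) (at s)"
    using U(5)[OF sU] gs by (intro has_derivative_minus) simp
  then have "(grad (dual_barrier K F) has_derivative (\<lambda>v. - (- inv (hess F z) v))) (at s)"
    by (rule has_derivative_transform_within_open[OF _ U(1) sU]) (simp add: U(4))
  then have "hess (dual_barrier K F) s = inv (hess F z)"
    unfolding hess_def by (simp add: frechet_derivative_at[symmetric])
  moreover have "inv (hess F z) v = (1 / \<mu>\<^sup>2) *\<^sub>R inv (hess F x) v"
  proof -
    have "hess F z ((1 / \<mu>\<^sup>2) *\<^sub>R inv (hess F x) v) = v"
      using hess_scale[OF x, of "1 / \<mu>"] \<mu>
      by (simp add: z_def linear_scale[OF X.linear_P] power2_eq_square)
    then show ?thesis by (metis Z.inv_P)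
  qed
  ultimately show ?thesis using s by simp
qed

end

section \<open>The central path\<close>

theorem mainTheorem8:
  fixes K :: "'e::euclidean_space set" and F :: "'e \<Rightarrow> real" and \<nu> :: real
    and A :: "'e \<Rightarrow> 'h::euclidean_space" and b :: 'h and c :: 'e
    and xc :: "real \<Rightarrow> 'e" and sc :: "real \<Rightarrow> 'e" and yc :: "real \<Rightarrow> 'h"
    and s_opt :: 'e and y_opt :: 'h and \<gamma>d \<sigma>d :: real
  assumes cone: "regular_cone K"
    and barrier: "normal_barrier K F \<nu>"
    and linA: "linear A"
    and primal_strict: "\<exists>x\<in>interior K. A x = b"
    and dual_strict: "\<exists>y. c - adjoint A y \<in> interior (dual_cone K)"
    and central_path: "\<And>\<mu>. \<mu> > 0 \<Longrightarrow>
          xc \<mu> \<in> interior K \<and> A (xc \<mu>) = b \<and> sc \<mu> + adjoint A (yc \<mu>) = c \<and>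
          sc \<mu> = - (\<mu> *\<^sub>R grad F (xc \<mu>))"
    and opt_pair: "s_opt + adjoint A y_opt = c" "s_opt \<in> dual_cone K"
                  "b \<bullet> y_opt = dual_opt K A b c"
    and assm1: "\<gamma>d > 0"
               "\<And>y. c - adjoint A y \<in> dual_cone K \<Longrightarrow>
                  dual_opt K A b c - b \<bullet> y \<ge> \<gamma>d * normG A (hess F (xc 1)) (y - y_opt)"
    and assm2: "\<And>\<mu>. \<mu> \<in> {0<..1} \<Longrightarrow>
                  normB (hess F (xc 1)) (hess (dual_barrier K F) (sc \<mu>) s_opt) \<le> \<sigma>d"
  shows "\<forall>\<mu>\<in>{0<..1}. \<forall>xd yd.
           (xc has_vector_derivative xd) (at \<mu>) \<longrightarrow> (yc has_vector_derivative yd) (at \<mu>) \<longrightarrow>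
             normG A (hess F (xc 1)) (yc \<mu> - \<mu> *\<^sub>R yd - y_opt)
               \<le> 4 * \<sigma>d * \<nu>\<^sup>2 / \<gamma>d\<^sup>2 * \<mu>\<^sup>2 \<and>
             normB (hess F (xc 1)) xd \<le> \<sigma>d * (1 + 16 * \<nu> ^ 4 / \<gamma>d\<^sup>2)"
proof (intro ballI allI impI)
  fix \<mu> :: real and xd :: 'e and yd :: 'h
  assume "\<mu> \<in> {0<..1}" and dx: "(xc has_vector_derivative xd) (at \<mu>)"
    and dy: "(yc has_vector_derivative yd) (at \<mu>)"
  then have \<mu>: "0 < \<mu>" "\<mu> \<le> 1" and \<mu>': "\<mu> \<in> {0<..1}" by auto
  interpret normal_barrier_cone K F \<nu> using cone barrier by unfold_locales
  define x where "x = xc \<mu>"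
  have x: "x \<in> interior K" and Ax: "A x = b" and s: "sc \<mu> = - (\<mu> *\<^sub>R grad F x)"
    and y: "c - adjoint A (yc \<mu>) = - (\<mu> *\<^sub>R grad F x)"
    using central_path[OF \<mu>(1)] by (auto simp: x_def algebra_simps)
  define x1 where "x1 = xc 1"
  have x1: "x1 \<in> interior K" and Ax1: "A x1 = b" and y1: "c - adjoint A (yc 1) = - grad F x1"
    using central_path[of 1] by (auto simp: x1_def algebra_simps)
  define B where "B = hess F x1"
  define H where "H = hess F x"
  interpret B: spd_operator B unfolding B_def by (rule spd_hess[OF x1])
  interpret H: spd_operator H unfolding H_def by (rule spd_hess[OF x])
  interpret B': spd_operator "inv B" by (rule B.spd_inv)
  interpret H': spd_operator "inv H" by (rule H.spd_inv)
  have linA': "linear (adjoint A)" by (rule adjoint_linear[OF linA])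
  have normG: "normG A (hess F (xc 1)) y = normB (inv B) (adjoint A y)" for y
    using B.normG_eq[OF linA] by (simp add: B_def x1_def)
  \<comment> \<open>By \<open>hess_dual_barrier\<close>, \<open>p\<close> is the vector whose
    \<open>B\<close>-norm the second assumption bounds.\<close>
  define p where "p = (1 / \<mu>\<^sup>2) *\<^sub>R inv H s_opt"
  have p: "normB B p \<le> \<sigma>d"
    using assm2[OF \<mu>'] hess_dual_barrier[OF x \<mu>(1), of s_opt] by (simp add: s p_def B_def H_def x1_def)
  have \<sigma>: "0 \<le> \<sigma>d" using p B.normB_nonneg[of p] by linarith

  \<comment> \<open>Derivative equations of the path\<close>
  have Axd: "A xd = 0"
  proof -
    have "((\<lambda>t. A (xc t)) has_vector_derivative A xd) (at \<mu>)"
      by (rule bounded_linear.has_vector_derivative[OF _ dx])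
        (simp add: linA linear_conv_bounded_linear[symmetric])
    moreover have "((\<lambda>t. A (xc t)) has_vector_derivative 0) (at \<mu>)"
      by (rule has_vector_derivative_transform_within_open[of "\<lambda>_. b" _ _ "{0<..}"])
        (use \<mu> central_path in auto)
    ultimately show ?thesis by (rule vector_derivative_unique_at)
  qed
  have s': "adjoint A yd = grad F x + \<mu> *\<^sub>R H xd"
  proof -
    have "(xc has_derivative (\<lambda>t. t *\<^sub>R xd)) (at \<mu>)"
      using dx by (simp add: has_vector_derivative_def)
    then have "((\<lambda>t. grad F (xc t)) has_derivative (\<lambda>t. H (t *\<^sub>R xd))) (at \<mu>)"
      unfolding H_def x_def
      by (rule has_derivative_compose[of xc _ _ _ "grad F"]) (rule grad_has_derivative[OF x[unfolded x_def]])
    then have dg: "((\<lambda>t. grad F (xc t)) has_vector_derivative H xd) (at \<mu>)"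
      by (simp add: has_vector_derivative_def linear_scale[OF H.linear_P])
    \<comment> \<open>Eliminating \<open>sc\<close> leaves an identity between \<open>xc\<close> and
      \<open>yc\<close> whose two sides can be differentiated.\<close>
    have path: "c + t *\<^sub>R grad F (xc t) = adjoint A (yc t)" if "t > 0" for t
    proof -
      have "- (t *\<^sub>R grad F (xc t)) + adjoint A (yc t) = c" using central_path[OF that] by metis
      then show ?thesis by (simp add: algebra_simps)
    qed
    have "((\<lambda>t. c + t *\<^sub>R grad F (xc t)) has_vector_derivative grad F x + \<mu> *\<^sub>R H xd) (at \<mu>)"
      by (rule derivative_eq_intros dg refl | simp add: x_def)+
    then have "((\<lambda>t. adjoint A (yc t)) has_vector_derivative grad F x + \<mu> *\<^sub>R H xd) (at \<mu>)"
      by (rule has_vector_derivative_transform_within_open[of _ _ _ "{0<..}"])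
        (use \<mu> path in auto)
    moreover have "((\<lambda>t. adjoint A (yc t)) has_vector_derivative adjoint A yd) (at \<mu>)"
      by (rule bounded_linear.has_vector_derivative[OF _ dy])
        (simp add: linA' linear_conv_bounded_linear[symmetric])
    ultimately show ?thesis by (metis vector_derivative_unique_at)
  qed

  \<comment> \<open>\<open>d\<close> is the error of extrapolating \<open>yc\<close> linearly from
    \<open>\<mu>\<close> to \<open>0\<close>; its \<open>G\<close>-norm is the \<open>inv B\<close>
    norm of \<open>v\<close>.\<close>
  define d where "d = yc \<mu> - \<mu> *\<^sub>R yd - y_opt"
  define v where "v = adjoint A d"
  have "v = s_opt - \<mu>\<^sup>2 *\<^sub>R H xd"
  proof -
    have "v = adjoint A (yc \<mu>) - \<mu> *\<^sub>R adjoint A yd - adjoint A y_opt"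
      by (simp add: v_def d_def linear_diff[OF linA'] linear_scale[OF linA'])
    moreover have "adjoint A (yc \<mu>) = c + \<mu> *\<^sub>R grad F x" using y by (simp add: algebra_simps)
    moreover have "adjoint A y_opt = c - s_opt" using opt_pair(1) by (simp add: algebra_simps)
    ultimately show ?thesis by (simp add: s' algebra_simps power2_eq_square)
  qed
  then have "s_opt - v = H (\<mu>\<^sup>2 *\<^sub>R xd)"
    by (simp add: linear_scale[OF H.linear_P])
  then have "inv H s_opt - inv H v = \<mu>\<^sup>2 *\<^sub>R xd"
    using linear_diff[OF H.linear_inv, of s_opt v] by simp
  then have "p - (1 / \<mu>\<^sup>2) *\<^sub>R inv H v = (1 / \<mu>\<^sup>2) *\<^sub>R (\<mu>\<^sup>2 *\<^sub>R xd)"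
    by (metis p_def scaleR_diff_right)
  then have xd: "xd = p - (1 / \<mu>\<^sup>2) *\<^sub>R inv H v"
    using \<mu> by simp

  txt \<open>The dual Dikin ellipsoid at \<open>s\<^sub>\<mu>\<close> is feasible in both directions \<open>\<plusminus>h\<close>, so the sharpness
    assumption limits its size by the duality gap \<open>\<nu>\<mu>\<close>.\<close>
  have gap: "dual_opt K A b c - b \<bullet> yc \<mu> \<le> \<nu> * \<mu>"
  proof -
    have "b \<bullet> yc \<mu> = x \<bullet> (c + \<mu> *\<^sub>R grad F x)"
    proof -
      have "c + \<mu> *\<^sub>R grad F x = adjoint A (yc \<mu>)" using y by (simp add: algebra_simps)
      then show ?thesis by (simp add: adjoint_works[OF linA] Ax)
    qed
    moreover have "b \<bullet> y_opt = x \<bullet> (c - s_opt)"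
      unfolding opt_pair(1)[symmetric] Ax[symmetric] by (simp add: adjoint_works[OF linA])
    \<comment> \<open>By Euler's identity the gap equals
      \<open>\<nu> * \<mu> - s_opt \<bullet> x\<close>; dual feasibility of \<open>s_opt\<close>
      discards the last term.\<close>
    moreover have "0 \<le> s_opt \<bullet> x" using opt_pair(2) x interior_subset by (auto simp: dual_cone_def)
    ultimately show ?thesis
      using grad_euler[OF x] by (simp add: opt_pair(3)[symmetric] inner_commute inner_add_right inner_diff_right)
  qed
  have size: "\<gamma>d * normB (inv B) (adjoint A h) \<le> \<nu> * \<mu>" if h: "normB (inv H) (adjoint A h) \<le> \<mu>" for h
  proof -
    have feas: "c - adjoint A (yc \<mu> + k) \<in> dual_cone K" if "normB (inv H) (- adjoint A k) \<le> \<mu>" for k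
    proof -
      have "c - adjoint A (yc \<mu> + k) = - adjoint A k + (c - adjoint A (yc \<mu>))"
        by (simp add: linear_add[OF linA'])
      then show ?thesis using dual_cone_ellipsoid[OF x that[unfolded H_def]] by (simp add: y)
    qed
    have "\<gamma>d * normB (inv B) (adjoint A (yc \<mu> + k - y_opt)) \<le> dual_opt K A b c - b \<bullet> (yc \<mu> + k)"
      if "normB (inv H) (- adjoint A k) \<le> \<mu>" for k
      using assm1(2)[OF feas[OF that]] by (simp add: normG)
    \<comment> \<open>Adding both signs cancels the terms \<open>b \<bullet> h\<close>; the offset
      \<open>yc \<mu> - y_opt\<close> is then removed by \<open>normB_double_le\<close>.\<close>
    from this[of h] this[of "- h"]
    have "\<gamma>d * normB (inv B) (adjoint A (yc \<mu> + h - y_opt)) + \<gamma>d * normB (inv B) (adjoint A (yc \<mu> - h - y_opt))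
        \<le> 2 * (dual_opt K A b c - b \<bullet> yc \<mu>)"
      using h H'.normB_scaleR[of "-1" "adjoint A h"]
      by (simp add: linear_neg[OF linA'] inner_add_right inner_diff_right)
    moreover have "2 * normB (inv B) (adjoint A h) \<le>
        normB (inv B) (adjoint A (yc \<mu> + h - y_opt)) + normB (inv B) (adjoint A (yc \<mu> - h - y_opt))"
      using B'.normB_double_le[of "adjoint A h" "adjoint A (yc \<mu> - y_opt)"]
      by (simp add: linear_add[OF linA'] linear_diff[OF linA'] algebra_simps)
    then have "\<gamma>d * (2 * normB (inv B) (adjoint A h)) \<le>
        \<gamma>d * (normB (inv B) (adjoint A (yc \<mu> + h - y_opt)) + normB (inv B) (adjoint A (yc \<mu> - h - y_opt)))"
      using assm1(1) by simp
    ultimately show ?thesis using gap by (simp add: algebra_simps)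
  qed
  have sharp: "\<gamma>d * normB (inv B) v \<le> \<nu> * normB (inv H) v"
  proof (cases "v = 0")
    case False
    then have n: "normB (inv H) v > 0" by (rule H'.normB_pos)
    \<comment> \<open>The rescaling puts \<open>adjoint A (t d)\<close> on the boundary of the
      ellipsoid, where \<open>size\<close> still applies; by homogeneity \<open>t\<close>
      cancels.\<close>
    define t where "t = \<mu> / normB (inv H) v"
    have t: "t > 0" "t * normB (inv H) v = \<mu>" using n \<mu> by (auto simp: t_def)
    have "normB (inv H) (adjoint A (t *\<^sub>R d)) \<le> \<mu>"
      using t H'.normB_scaleR[of t v] by (simp add: linear_scale[OF linA'] v_def)
    from size[OF this] have "t * (\<gamma>d * normB (inv B) v) \<le> t * (\<nu> * normB (inv H) v)"
      using t B'.normB_scaleR[of t v]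
      by (simp add: linear_scale[OF linA'] v_def[symmetric] mult.left_commute)
    then show ?thesis using t by simp
  qed (simp add: normB_def)

  \<comment> \<open>\<open>v\<close> is in the range of the adjoint and \<open>xd\<close> in the
    kernel of \<open>A\<close>; pairing \<open>v\<close> with the decomposition of \<open>xd\<close>
    expresses its \<open>inv H\<close> norm through \<open>p\<close>.\<close>
  have "v \<bullet> xd = 0" using Axd by (simp add: v_def inner_commute[of _ xd] adjoint_works[OF linA])
  then have "(normB (inv H) v)\<^sup>2 = \<mu>\<^sup>2 * (v \<bullet> p)"
    using \<mu> by (simp add: xd H'.normB_sq inner_diff_right inner_commute)
  moreover have "v \<bullet> p \<le> normB (inv B) v * \<sigma>d"
    using B.dual_Cauchy_Schwarz[of v p] mult_left_mono[OF p B'.normB_nonneg[of v]] by linarith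
  ultimately have Hv: "(normB (inv H) v)\<^sup>2 \<le> \<mu>\<^sup>2 * (normB (inv B) v * \<sigma>d)"
    by (simp add: mult_left_mono)
  have d_le: "normB (inv B) v \<le> \<sigma>d * \<nu>\<^sup>2 / \<gamma>d\<^sup>2 * \<mu>\<^sup>2"
  proof (cases "v = 0")
    case True
    then show ?thesis using \<sigma> by (simp add: normB_def)
  next
    case False
    then have n: "normB (inv B) v > 0" by (rule B'.normB_pos)
    \<comment> \<open>\<open>sharp\<close> is squared so that \<open>Hv\<close> can be inserted; one
      factor \<open>normB (inv B) v\<close> then cancels.\<close>
    have "(\<gamma>d * normB (inv B) v)\<^sup>2 \<le> (\<nu> * normB (inv H) v)\<^sup>2"
      using sharp assm1(1) n by (intro power_mono) auto
    also have "\<dots> \<le> \<nu>\<^sup>2 * (\<mu>\<^sup>2 * (normB (inv B) v * \<sigma>d))"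
      using Hv by (simp add: power_mult_distrib mult_left_mono)
    finally have "normB (inv B) v * (\<gamma>d\<^sup>2 * normB (inv B) v) \<le> normB (inv B) v * (\<sigma>d * \<nu>\<^sup>2 * \<mu>\<^sup>2)"
      by (simp add: power2_eq_square mult_ac)
    then show ?thesis using n assm1(1) by (simp add: field_simps)
  qed

  txt \<open>Orthogonality \<open>\<langle>s\<^sub>1 - s\<^sub>\<mu>, x\<^sub>1 - x\<^sub>\<mu>\<rangle> = 0\<close> bounds \<open>\<langle>s\<^sub>1, x\<^sub>\<mu>\<rangle>\<close>, which makes the metrics \<open>B\<close> and \<open>H\<close> comparable.\<close>
  have "- (grad F x1 \<bullet> x) \<le> 2 * \<nu>"
  proof -
    have "grad F x1 - \<mu> *\<^sub>R grad F x = (c - adjoint A (yc \<mu>)) - (c - adjoint A (yc 1))"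
      unfolding y y1 by simp
    also have "\<dots> = adjoint A (yc 1) - adjoint A (yc \<mu>)" by simp
    also have "(x1 - x) \<bullet> \<dots> = 0"
      by (simp add: inner_diff_right adjoint_works[OF linA] linear_diff[OF linA] Ax Ax1)
    finally have "grad F x1 \<bullet> x1 - grad F x1 \<bullet> x - \<mu> * (grad F x \<bullet> x1) + \<mu> * (grad F x \<bullet> x) = 0"
      by (simp add: inner_diff_right inner_diff_left inner_commute right_diff_distrib)
    moreover have "\<mu> * (grad F x \<bullet> x1) \<le> 0"
      using grad_nonpos[OF x subsetD[OF interior_subset x1]] \<mu> by (simp add: mult_nonneg_nonpos)
    moreover have "\<mu> * \<nu> \<le> \<nu>" using \<mu> nu_nonneg by (simp add: mult_left_le_one_le)
    ultimately show ?thesis using grad_euler[OF x] grad_euler[OF x1] by simp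
  qed
  \<comment> \<open>The factor \<open>2\<close> of \<open>normB_hess_compare\<close> meets the bound
    \<open>2 * \<nu>\<close>, whence \<open>4 * \<nu>\<close>.\<close>
  then have "2 * (- (grad F x1 \<bullet> x)) * normB H h \<le> 4 * \<nu> * normB H h" for h
    by (intro mult_right_mono) (auto simp: H.normB_nonneg)
  then have compare: "normB B h \<le> 4 * \<nu> * normB H h" for h
    using normB_hess_compare[OF x x1, of h] unfolding B_def H_def by (rule order_trans[rotated])
  \<comment> \<open>\<open>q\<close> is the correction in \<open>xd\<close>. Its squared
    \<open>B\<close>-norm is at most \<open>16 * \<nu>\<^sup>2 * (v \<bullet> q)\<close>, which
    Cauchy-Schwarz bounds linearly in \<open>normB B q\<close>, so one factor cancels.\<close>
  define q where "q = inv H v"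
  have q: "normB B q \<le> 16 * \<nu>\<^sup>2 * normB (inv B) v"
  proof (cases "q = 0")
    case True
    then show ?thesis using B'.normB_nonneg[of v] by (simp add: normB_def)
  next
    case False
    then have n: "normB B q > 0" by (rule B.normB_pos)
    have "(normB B q)\<^sup>2 \<le> (4 * \<nu> * normB H q)\<^sup>2"
      by (rule power_mono[OF compare B.normB_nonneg])
    also have "\<dots> = 16 * \<nu>\<^sup>2 * (v \<bullet> q)"
      by (simp add: power_mult_distrib H.normB_sq q_def)
    also have "\<dots> \<le> 16 * \<nu>\<^sup>2 * (normB (inv B) v * normB B q)"
      using B.dual_Cauchy_Schwarz[of v q] by (intro mult_left_mono) auto
    finally have "normB B q * normB B q \<le> (16 * \<nu>\<^sup>2 * normB (inv B) v) * normB B q"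
      by (simp add: power2_eq_square mult_ac)
    then show ?thesis using n by simp
  qed
  have "normB B xd \<le> normB B p + (1 / \<mu>\<^sup>2) * normB B q"
    using B.normB_diff_le[of p "(1 / \<mu>\<^sup>2) *\<^sub>R q"] by (simp add: xd q_def B.normB_scaleR)
  \<comment> \<open>The factor \<open>\<mu>\<^sup>2\<close> in \<open>d_le\<close> absorbs the
    division, so the bound is uniform in \<open>\<mu>\<close>.\<close>
  also have "\<dots> \<le> \<sigma>d + (1 / \<mu>\<^sup>2) * (16 * \<nu>\<^sup>2 * (\<sigma>d * \<nu>\<^sup>2 / \<gamma>d\<^sup>2 * \<mu>\<^sup>2))"
    using q mult_left_mono[OF d_le, of "16 * \<nu>\<^sup>2"] by (intro add_mono p mult_left_mono) auto
  also have "\<dots> = \<sigma>d * (1 + 16 * \<nu> ^ 4 / \<gamma>d\<^sup>2)"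
    using \<mu> assm1(1) by (simp add: field_simps power2_eq_square power4_eq_xxxx)
  finally have *: "normB B xd \<le> \<sigma>d * (1 + 16 * \<nu> ^ 4 / \<gamma>d\<^sup>2)" .
  \<comment> \<open>\<open>d_le\<close> has constant \<open>1\<close>; the stated constant
    \<open>4\<close> follows since \<open>\<sigma>d\<close> is nonnegative.\<close>
  have "\<sigma>d * \<nu>\<^sup>2 / \<gamma>d\<^sup>2 * \<mu>\<^sup>2 \<le> 4 * \<sigma>d * \<nu>\<^sup>2 / \<gamma>d\<^sup>2 * \<mu>\<^sup>2"
    using \<sigma> by (intro mult_right_mono divide_right_mono) auto
  then have "normG A (hess F (xc 1)) d \<le> 4 * \<sigma>d * \<nu>\<^sup>2 / \<gamma>d\<^sup>2 * \<mu>\<^sup>2"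
    using d_le by (simp add: normG v_def)
  with * show "normG A (hess F (xc 1)) (yc \<mu> - \<mu> *\<^sub>R yd - y_opt) \<le> 4 * \<sigma>d * \<nu>\<^sup>2 / \<gamma>d\<^sup>2 * \<mu>\<^sup>2 \<and>
      normB (hess F (xc 1)) xd \<le> \<sigma>d * (1 + 16 * \<nu> ^ 4 / \<gamma>d\<^sup>2)"
    by (simp add: d_def B_def x1_def)
qed

end
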